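(* Let $\psi$, $f$, $I$, $p$ be as in the context, and consider the linear second-order PDE for a function $\xi(H,r)$ on a domain in $\mathbb{R}\times I$: $$\frac{\partial^{2}\xi}{\partial H^{2}}+\frac{1}{p(r)}\frac{\partial}{\partial r}\Big(p(r)\frac{\partial \xi}{\partial r}\Big)=0. \qquad (3)$$ (a) Suppose $\xi_1,\xi_2$ are solutions of (3) near a point $(H_0,r_0)$ and that the Jacobian determinant $\det\big(\partial(\xi_1,\xi_2)/\partial(H,r)\big)$ is positive at $(H_0,r_0)$. Define the 1-forms $$\epsilon_1=p(r)\Big(\frac{\partial\xi_2}{\partial r}\,dH-\frac{\partial\xi_2}{\partial H}\,dr\Big),\quad \epsilon_2=p(r)\Big(-\frac{\partial\xi_1}{\partial r}\,dH+\frac{\partial\xi_1}{\partial H}\,dr\Big),\quad \epsilon=\xi_1\epsilon_1+\xi_2\epsilon_2.$$ Then $\epsilon,\epsilon_1,\epsilon_2$ are closed and $\epsilon_1\wedge\epsilon_2$ is nonvanishing near $(H_0,r_0)$. Hence locally there are functions $u,x_1,x_2$ with $du=\epsilon$, $dx_1=\epsilon_1$, $dx_2=\epsilon_2$, and $(x_1,x_2)$ are local coordinates near $(H_0,r_0)$. Regarding $u$ as a function of $(x_1,x_2)$ on a suitable domain, $u$ is a solution of equation (2) (with $n=2$), $\partial u/\partial x_i=\xi_i$, and every point of this domain is an ordinary point. (b) Conversely, let $u$ be a (strictly) convex solution of (2) with $n=2$ near an ordinary point. Then, in a neighbourhood of that point, $u$ arises by the construction in (a): there are local coordinates $(H,r)$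 with $r=f(J)$ and solutions $\xi_1,\xi_2$ of (3) (namely $\xi_i=\partial u/\partial x_i$ expressed in the coordinates $(H,r)$) with $\det(\partial(\xi_1,\xi_2)/\partial(H,r))>0$, such that $u,x_1,x_2$ are recovered from $\xi_1,\xi_2$ as in (a) up to additive constants. The solutions $\xi_1,\xi_2$ are unique up to translation in the variable $H$ and the addition of constants.
   Context: Let $\psi$ be a smooth, strictly convex function on $(0,\infty)$. For a strictly convex function $u(x_1,\dots,x_n)$ on a domain in $\mathbb{R}^n$ write $u_{ij}=\partial^2u/\partial x_i\partial x_j$, $J=\det(u_{ij})>0$, and $(u^{ij})$ for the inverse matrix of $(u_{ij})$. Equation (2) is the fourth-order PDE $$\sum_{i,j}\frac{\partial^{2}}{\partial x_i\partial x_j}\big(J\psi'(J)u^{ij}\big)=0$$ (the Euler–Lagrange equation of $\int\psi(J)\,dx$). A point is an ordinary point of $u$ if $\nabla J\neq 0$ there. Let $f$ be a solution of $f'(t)=t^{1/2}\psi''(t)$ on $(0,\infty)$; then $f$ is strictly increasing and maps $(0,\infty)$ bijectively onto an interval $I$. Define $p:I\to(0,\infty)$ by $p(r)=\big(f^{-1}(r)\big)^{-1/2}$, i.e. $J^{-1/2}=p(r)$ when $r=f(J)$.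
   Formalization: Strict convexity of ψ is taken in the strong sense ψ''>0 on (0,∞); if ψ'' vanishes at some t₀, then p is not differentiable at f(t₀) and the claims about ordinary points and coordinates fail there. Solutions of (2) and (3) are understood to be smooth. *)

theory Defs
  imports "HOL-Analysis.Analysis"
begin

text \<open>Points of the plane (both the (x1,x2)-plane and the (H,r)-plane) are
vectors of type real^2; for the (H,r)-plane, H = z$1 and r = z$2.\<close>

definition pd :: "'n \<Rightarrow> (real^'n \<Rightarrow> real) \<Rightarrow> real^'n \<Rightarrow> real" where
  "pd i g z = deriv (\<lambda>t. g (z + t *\<^sub>R axis i 1)) 0"

fun iter_pd :: "'n list \<Rightarrow> (real^'n \<Rightarrow> real) \<Rightarrow> real^'n \<Rightarrow> real" where
  "iter_pd [] g = g"
| "iter_pd (i # is) g = pd i (iter_pd is g)"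

definition smooth_on :: "(real^'n) set \<Rightarrow> (real^'n \<Rightarrow> real) \<Rightarrow> bool" where
  "smooth_on S g \<longleftrightarrow> (\<forall>is. \<forall>z\<in>S. continuous (at z) (iter_pd is g) \<and>
      (\<forall>i. (\<lambda>t. iter_pd is g (z + t *\<^sub>R axis i 1)) differentiable (at 0)))"

definition smooth1_on :: "real set \<Rightarrow> (real \<Rightarrow> real) \<Rightarrow> bool" where
  "smooth1_on S g \<longleftrightarrow> (\<forall>k. \<forall>x\<in>S. ((deriv ^^ k) g) differentiable (at x))"

text \<open>Strict convexity (the library only has convex_on, which includes convexity of S).\<close>
definition strictly_convex_on :: "'a::real_vector set \<Rightarrow> ('a \<Rightarrow> real) \<Rightarrow> bool" where
  "strictly_convex_on S g \<longleftrightarrow> convex_on S g \<and>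
     (\<forall>x\<in>S. \<forall>y\<in>S. x \<noteq> y \<longrightarrow> (\<forall>t. 0 < t \<and> t < 1 \<longrightarrow>
        g ((1 - t) *\<^sub>R x + t *\<^sub>R y) < (1 - t) * g x + t * g y))"

definition hess :: "(real^'n \<Rightarrow> real) \<Rightarrow> real^'n \<Rightarrow> real^'n^'n" where
  "hess u z = (\<chi> i j. pd i (pd j u) z)"

definition hessdet :: "(real^'n \<Rightarrow> real) \<Rightarrow> real^'n \<Rightarrow> real" where
  "hessdet u z = det (hess u z)"

definition eq2 :: "(real \<Rightarrow> real) \<Rightarrow> (real^'n) set \<Rightarrow> (real^'n \<Rightarrow> real) \<Rightarrow> bool" where
  "eq2 \<psi> \<Omega> u \<longleftrightarrow> (\<forall>z\<in>\<Omega>. (\<Sum>i\<in>UNIV. \<Sum>j\<in>UNIV.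
      pd i (pd j (\<lambda>w. hessdet u w * deriv \<psi> (hessdet u w) * matrix_inv (hess u w) $ i $ j)) z) = 0)"

definition ordinary :: "(real^'n \<Rightarrow> real) \<Rightarrow> real^'n \<Rightarrow> bool" where
  "ordinary u z \<longleftrightarrow> (\<chi> i. pd i (hessdet u) z) \<noteq> 0"

text \<open>p(r) = (f^{-1}(r))^{-1/2}, f viewed as a bijection from (0,inf) onto I = f`(0,inf).\<close>
definition pfun :: "(real \<Rightarrow> real) \<Rightarrow> real \<Rightarrow> real" where
  "pfun f r = inv_into {0<..} f r powr (-1/2)"

definition eq3 :: "(real \<Rightarrow> real) \<Rightarrow> (real^2) set \<Rightarrow> (real^2 \<Rightarrow> real) \<Rightarrow> bool" where
  "eq3 p S \<xi> \<longleftrightarrow> smooth_on S \<xi> \<and>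
     (\<forall>z\<in>S. (\<lambda>t. p ((z + t *\<^sub>R axis 2 1) $ 2) * pd 2 \<xi> (z + t *\<^sub>R axis 2 1)) differentiable (at 0) \<and>
        pd 1 (pd 1 \<xi>) z + (1 / p (z $ 2)) * pd 2 (\<lambda>w. p (w $ 2) * pd 2 \<xi> w) z = 0)"

definition jacdet :: "(real^2 \<Rightarrow> real) \<Rightarrow> (real^2 \<Rightarrow> real) \<Rightarrow> real^2 \<Rightarrow> real" where
  "jacdet \<xi>1 \<xi>2 z = pd 1 \<xi>1 z * pd 2 \<xi>2 z - pd 2 \<xi>1 z * pd 1 \<xi>2 z"

text \<open>A 1-form a dH + b dr on the (H,r)-plane is represented by the pair (a,b).\<close>
type_synonym form1 = "(real^2 \<Rightarrow> real) \<times> (real^2 \<Rightarrow> real)"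

definition eps1 :: "(real \<Rightarrow> real) \<Rightarrow> (real^2 \<Rightarrow> real) \<Rightarrow> (real^2 \<Rightarrow> real) \<Rightarrow> form1" where
  "eps1 p \<xi>1 \<xi>2 = (\<lambda>z. p (z $ 2) * pd 2 \<xi>2 z, \<lambda>z. - (p (z $ 2) * pd 1 \<xi>2 z))"

definition eps2 :: "(real \<Rightarrow> real) \<Rightarrow> (real^2 \<Rightarrow> real) \<Rightarrow> (real^2 \<Rightarrow> real) \<Rightarrow> form1" where
  "eps2 p \<xi>1 \<xi>2 = (\<lambda>z. - (p (z $ 2) * pd 2 \<xi>1 z), \<lambda>z. p (z $ 2) * pd 1 \<xi>1 z)"

definition eps :: "(real \<Rightarrow> real) \<Rightarrow> (real^2 \<Rightarrow> real) \<Rightarrow> (real^2 \<Rightarrow> real) \<Rightarrow> form1" where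
  "eps p \<xi>1 \<xi>2 =
     (\<lambda>z. \<xi>1 z * fst (eps1 p \<xi>1 \<xi>2) z + \<xi>2 z * fst (eps2 p \<xi>1 \<xi>2) z,
      \<lambda>z. \<xi>1 z * snd (eps1 p \<xi>1 \<xi>2) z + \<xi>2 z * snd (eps2 p \<xi>1 \<xi>2) z)"

text \<open>d(a dH + b dr) = (b_H - a_r) dH /\ dr = 0 on S.\<close>
definition closed_form :: "(real^2) set \<Rightarrow> form1 \<Rightarrow> bool" where
  "closed_form S \<omega> \<longleftrightarrow> (\<forall>z\<in>S.
      (\<lambda>t. fst \<omega> (z + t *\<^sub>R axis 2 1)) differentiable (at 0) \<and>
      (\<lambda>t. snd \<omega> (z + t *\<^sub>R axis 1 1)) differentiable (at 0) \<and>
      pd 2 (fst \<omega>) z = pd 1 (snd \<omega>) z)"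

text \<open>Coefficient of dH /\ dr in omega /\ eta.\<close>
definition wedge :: "form1 \<Rightarrow> form1 \<Rightarrow> real^2 \<Rightarrow> real" where
  "wedge \<omega> \<eta> z = fst \<omega> z * snd \<eta> z - snd \<omega> z * fst \<eta> z"

definition has_differential :: "(real^2 \<Rightarrow> real) \<Rightarrow> form1 \<Rightarrow> (real^2) set \<Rightarrow> bool" where
  "has_differential g \<omega> S \<longleftrightarrow>
     (\<forall>z\<in>S. (g has_derivative (\<lambda>v. fst \<omega> z * v $ 1 + snd \<omega> z * v $ 2)) (at z))"

end

theory Submission
  imports Defs
begin

text \<open>
In two variables the cofactors of the Hessian are the second derivatives of \<open>u\<close> itself, and they are
divergence free, so equation (2) says that the field with components \<open>g\<^sub>1 u\<^sub>2\<^sub>2 - g\<^sub>2 u\<^sub>1\<^sub>2\<close> and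
\<open>g\<^sub>2 u\<^sub>1\<^sub>1 - g\<^sub>1 u\<^sub>1\<^sub>2\<close>, where \<open>g = \<psi>'(J)\<close>, is divergence free. Its stream function is the coordinate \<open>H\<close>.
Since \<open>r = f(J)\<close> satisfies \<open>g\<^sub>i = p(r) r\<^sub>i\<close>, the Jacobian of \<open>(H, r)\<close> is \<open>p\<close> times the cofactor quadratic form of the
Hessian at \<open>\<nabla>r\<close>, hence positive at ordinary points. In the coordinates \<open>(H, r)\<close> the definition of \<open>H\<close>
turns into the Cauchy-Riemann type system \<open>dx\<^sub>1 = \<epsilon>\<^sub>1\<close>, \<open>dx\<^sub>2 = \<epsilon>\<^sub>2\<close> for \<open>\<xi>\<^sub>i = u\<^sub>i\<close>, whose integrability
condition is equation (3). Read backwards, these identities give \<open>J = 1/p\<^sup>2\<close>, a positive definite Hessian and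
equation (2); they also determine \<open>dH\<close> from \<open>u\<close>, which is the uniqueness statement.
\<close>

section \<open>Differentials in the plane\<close>

text \<open>The square root in \<open>f' = sqrt t * psi''\<close> normalizes
  \<open>p(r)^2 J = 1\<close>. With R a quarter turn, the matrix \<open>p R D^2u\<close> then
  squares to minus the identity, because (R A)^2 = -det A for symmetric A. So it is a complex
  structure, \<open>dH\<close> is up to sign \<open>dr\<close> composed with it, and (H, r) are
  isothermal coordinates of the metric \<open>u_ij\<close>. This is why the relations between x, xi
  and (H, r) can be solved in both directions by 2x2 algebra. The obstacle that shapes the first
  half is regularity: \<open>pd\<close> is built on the total operator \<open>deriv\<close>, and
  smoothness is phrased through iterated derivatives along coordinate lines. Chain rule, symmetry of
  mixed partials, primitives and smooth inverse maps must be brought to that form; the class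
  \<open>ck\<close>, defined by total differentials, carries these arguments. The locale
  \<open>hodograph\<close> serves twice: for the construction in (a), and for uniqueness in (b),
  where a competing pair of solutions is an instance of it with the given \<open>u\<close>. The pair
  is then the gradient of that \<open>u\<close>, which leaves no room for additive
  constants.\<close>

definition pt :: "real \<Rightarrow> real \<Rightarrow> real^2" where
  "pt x y = x *\<^sub>R axis 1 1 + y *\<^sub>R axis 2 1"

lemma pt_nth [simp]: "pt x y $ 1 = x" "pt x y $ 2 = y"
  by (simp_all add: pt_def axis_def)

lemma pt_eta [simp]: "pt (z $ 1) (z $ 2) = z"
  by (simp add: vec_eq_iff forall_2)

lemma continuous_on_pt [continuous_intros]:
  "continuous_on S f \<Longrightarrow> continuous_on S g \<Longrightarrow> continuous_on S (\<lambda>x. pt (f x) (g x))"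
  unfolding pt_def by (intro continuous_intros)

lemma has_derivative_pt [derivative_intros]:
  "(f has_derivative f') F \<Longrightarrow> (g has_derivative g') F \<Longrightarrow>
    ((\<lambda>x. pt (f x) (g x)) has_derivative (\<lambda>v. pt (f' v) (g' v))) F"
  unfolding pt_def by (intro derivative_intros)

lemma has_derivative_vec_nth [derivative_intros]:
  "(f has_derivative f') F \<Longrightarrow> ((\<lambda>x. f x $ i) has_derivative (\<lambda>v. f' v $ i)) F"
  by (rule bounded_linear.has_derivative[OF bounded_linear_vec_nth])

lemma dist_pt_le: "dist (pt x y) z \<le> \<bar>x - z $ 1\<bar> + \<bar>y - z $ 2\<bar>"
  using norm_le_l1_cart[of "pt x y - z"] by (simp add: dist_norm sum_2)

lemma axis_pt: "axis 1 1 = pt 1 0" "axis 2 1 = pt 0 1"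
  by (simp_all add: vec_eq_iff forall_2) (simp_all add: axis_def)

lemma add_axis_pt: "z + t *\<^sub>R axis 1 1 = pt (z $ 1 + t) (z $ 2)" "z + t *\<^sub>R axis 2 1 = pt (z $ 1) (z $ 2 + t)"
  by (simp_all add: vec_eq_iff forall_2) (simp_all add: axis_def)

lemma has_differentialD:
  assumes "has_differential g (a, b) S" "z \<in> S"
  shows "(g has_derivative (\<lambda>v. a z * v $ 1 + b z * v $ 2)) (at z)"
  using assms by (simp add: has_differential_def)

lemma has_derivative_partial_derivs:
  fixes z :: "real^2"
  assumes "(g has_derivative (\<lambda>v. a * v $ 1 + b * v $ 2)) (at z)"
  shows "((\<lambda>t. g (z + t *\<^sub>R axis 1 1)) has_real_derivative a) (at 0)"
    and "((\<lambda>t. g (z + t *\<^sub>R axis 2 1)) has_real_derivative b) (at 0)"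
proof -
  have *: "((\<lambda>t. g (z + t *\<^sub>R w)) has_derivative (\<lambda>t. a * (t *\<^sub>R w) $ 1 + b * (t *\<^sub>R w) $ 2)) (at 0)" for w
    by (rule has_derivative_compose[of "\<lambda>t. z + t *\<^sub>R w" "\<lambda>t. t *\<^sub>R w" 0 UNIV g])
      (auto intro!: derivative_eq_intros assms)
  show "((\<lambda>t. g (z + t *\<^sub>R axis 1 1)) has_real_derivative a) (at 0)"
    using *[of "axis 1 1"] by (simp add: has_field_derivative_def axis_pt mult_commute_abs)
  show "((\<lambda>t. g (z + t *\<^sub>R axis 2 1)) has_real_derivative b) (at 0)"
    using *[of "axis 2 1"] by (simp add: has_field_derivative_def axis_pt mult_commute_abs)
qed

lemma pd_eqI:
  fixes z :: "real^2"
  assumes "(g has_derivative (\<lambda>v. a * v $ 1 + b * v $ 2)) (at z)"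
  shows "pd 1 g z = a" "pd 2 g z = b"
  using has_derivative_partial_derivs[OF assms] by (auto simp: pd_def DERIV_imp_deriv)

lemma partial_differentiable:
  fixes z :: "real^2"
  assumes "(g has_derivative (\<lambda>v. a * v $ 1 + b * v $ 2)) (at z)"
  shows "(\<lambda>t. g (z + t *\<^sub>R axis i 1)) differentiable (at 0)"
  using has_derivative_partial_derivs[OF assms] exhaust_2[of i]
  by (auto simp: real_differentiable_def)

lemma has_differential_pd:
  assumes "has_differential g (a, b) S" "z \<in> S"
  shows "pd 1 g z = a z" "pd 2 g z = b z"
  using pd_eqI[OF has_differentialD[OF assms]] by auto

lemma has_differential_cong:
  assumes "open S" "has_differential g (a, b) S" "\<And>z. z \<in> S \<Longrightarrow> g z = h z"
    "\<And>z. z \<in> S \<Longrightarrow> a z = a' z" "\<And>z. z \<in> S \<Longrightarrow> b z = b' z"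
  shows "has_differential h (a', b') S"
  unfolding has_differential_def fst_conv snd_conv
proof
  fix z assume z: "z \<in> S"
  then show "(h has_derivative (\<lambda>v. a' z * v $ 1 + b' z * v $ 2)) (at z)"
    using has_derivative_transform_within_open[OF has_differentialD[OF assms(2) z] assms(1) z assms(3)]
      assms(4,5) by simp
qed

lemma pd_cong:
  assumes "open S" "z \<in> S" "\<And>w. w \<in> S \<Longrightarrow> g w = h w"
  shows "pd i g z = pd i h z"
proof -
  have "continuous (at 0) (\<lambda>t. z + t *\<^sub>R axis i 1)"
    by (intro continuous_intros)
  then have "((\<lambda>t. z + t *\<^sub>R axis i 1) \<longlongrightarrow> z) (nhds 0)"
    using tendsto_at_iff_tendsto_nhds[of "\<lambda>t. z + t *\<^sub>R axis i 1" 0] by (simp add: continuous_at)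
  then have "\<forall>\<^sub>F t in nhds 0. z + t *\<^sub>R axis i 1 \<in> S"
    using assms(1,2) by (rule topological_tendstoD)
  then have "\<forall>\<^sub>F t in nhds 0. g (z + t *\<^sub>R axis i 1) = h (z + t *\<^sub>R axis i 1)"
    by (rule eventually_mono) (simp add: assms(3))
  then show ?thesis
    unfolding pd_def by (intro deriv_cong_ev) auto
qed

lemma has_differential_subset:
  "has_differential g \<omega> S \<Longrightarrow> T \<subseteq> S \<Longrightarrow> has_differential g \<omega> T"
  by (auto simp: has_differential_def)

text \<open>The criterion for total differentiability asks for one partial at the point and for the
  other nearby, continuous. It lives on \<open>real \<times> real\<close>, so the point is
  surrounded by an open box and the result is carried back along the linear map
  \<open>v \<mapsto> (v $ 1, v $ 2)\<close>.\<close>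

lemma has_derivative_of_partials:
  fixes z :: "real^2"
  assumes S: "open S" "z \<in> S"
    and a: "((\<lambda>t. g (z + t *\<^sub>R axis 1 1)) has_real_derivative a) (at 0)"
    and b: "\<And>w. w \<in> S \<Longrightarrow> ((\<lambda>t. g (w + t *\<^sub>R axis 2 1)) has_real_derivative b w) (at 0)"
    and cont: "continuous_on S b"
  shows "(g has_derivative (\<lambda>v. a * v $ 1 + b z * v $ 2)) (at z)"
proof -
  obtain e where e: "e > 0" "ball z e \<subseteq> S"
    using S openE by blast
  \<comment> \<open>Half-widths e/2, since the distance is bounded by the sum of the two coordinate
    differences.\<close>
  define X where "X = {z $ 1 - e/2 <..< z $ 1 + e/2}"
  define Y where "Y = {z $ 2 - e/2 <..< z $ 2 + e/2}"
  have inS: "pt x y \<in> S" if "x \<in> X" "y \<in> Y" for x y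
  proof -
    have "dist (pt x y) z < e"
      using dist_pt_le[of x y z] that by (auto simp: X_def Y_def abs_if split: if_splits)
    then show ?thesis using e by (auto simp: dist_commute)
  qed
  have zXY: "z $ 1 \<in> X" "z $ 2 \<in> Y" using e by (auto simp: X_def Y_def)
  have 1: "((\<lambda>x. g (pt x (z $ 2))) has_derivative (\<lambda>t. a * t)) (at (z $ 1) within X)"
  proof -
    have "((\<lambda>x. g (pt x (z $ 2))) has_real_derivative a) (at (0 + z $ 1))"
      using a by (subst DERIV_shift) (simp add: add_axis_pt add.commute)
    then show ?thesis by (auto simp: has_field_derivative_def intro: has_derivative_at_withinI)
  qed
  have 2: "((\<lambda>y. g (pt x y)) has_derivative blinfun_apply (blinfun_mult_right (b (pt x y)))) (at y within Y)"
    if "x \<in> X" "y \<in> Y" for x y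
  proof -
    have "((\<lambda>y. g (pt x y)) has_real_derivative b (pt x y)) (at (0 + y))"
      using b[OF inS[OF that]] by (subst DERIV_shift) (simp add: add_axis_pt add.commute)
    then show ?thesis by (auto simp: has_field_derivative_def intro: has_derivative_at_withinI)
  qed
  have "continuous_on (X \<times> Y) (\<lambda>u. b (pt (fst u) (snd u)))"
    by (rule continuous_on_compose2[OF cont]) (auto intro!: continuous_intros inS)
  then have "continuous_on (X \<times> Y) (\<lambda>u. blinfun_mult_right (b (pt (fst u) (snd u))))"
    by (intro continuous_intros)
  then have 3: "continuous (at (z $ 1, z $ 2) within X \<times> Y) (\<lambda>(x, y). blinfun_mult_right (b (pt x y)))"
    using zXY by (simp add: continuous_on_eq_continuous_within case_prod_beta')
  have 4: "((\<lambda>(x, y). g (pt x y)) has_derivative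
      (\<lambda>(tx, ty). a * tx + blinfun_mult_right (b (pt (z $ 1) (z $ 2))) ty)) (at (z $ 1, z $ 2) within X \<times> Y)"
    by (rule has_derivative_partialsI[OF 1 2 3]) (use zXY in \<open>auto simp: Y_def\<close>)
  have "open (X \<times> Y)" by (intro open_Times) (auto simp: X_def Y_def)
  then have 5: "((\<lambda>u. g (pt (fst u) (snd u))) has_derivative
      (\<lambda>u. a * fst u + b z * snd u)) (at (z $ 1, z $ 2))"
    using 4 at_within_open[of "(z $ 1, z $ 2)" "X \<times> Y"] zXY by (simp add: case_prod_beta')
  show ?thesis
    using has_derivative_compose[of "\<lambda>v. (v $ 1, v $ 2)" "\<lambda>v. (v $ 1, v $ 2)" z UNIV, OF _ 5]
    by (simp add: bounded_linear.has_derivative[OF bounded_linear_vec_nth has_derivative_ident]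
        has_derivative_Pair)
qed

lemma has_differential_of_partials:
  assumes S: "open S"
    and a: "\<And>w. w \<in> S \<Longrightarrow> ((\<lambda>t. g (w + t *\<^sub>R axis 1 1)) has_real_derivative a w) (at 0)"
    and b: "\<And>w. w \<in> S \<Longrightarrow> ((\<lambda>t. g (w + t *\<^sub>R axis 2 1)) has_real_derivative b w) (at 0)"
    and cont: "continuous_on S b"
  shows "has_differential g (a, b) S"
  unfolding has_differential_def using has_derivative_of_partials[OF S _ a b cont] by auto

section \<open>Smooth functions\<close>

text \<open>The class C^k. The coefficients of the differential are existential rather than
  \<open>pd 1 g\<close> and \<open>pd 2 g\<close>: closure proofs can exhibit them as explicit terms
  and feed those to the induction hypothesis. On open sets \<open>ck_SucD\<close> identifies them
  with the partial derivatives.\<close>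

fun ck :: "nat \<Rightarrow> (real^2) set \<Rightarrow> (real^2 \<Rightarrow> real) \<Rightarrow> bool" where
  "ck 0 S g \<longleftrightarrow> continuous_on S g"
| "ck (Suc k) S g \<longleftrightarrow> (\<exists>a b. has_differential g (a, b) S \<and> ck k S a \<and> ck k S b)"

lemma ck_SucI: "has_differential g (a, b) S \<Longrightarrow> ck k S a \<Longrightarrow> ck k S b \<Longrightarrow> ck (Suc k) S g"
  by auto

lemma ck_cong:
  assumes "open S" "ck k S g" "\<And>z. z \<in> S \<Longrightarrow> g z = h z"
  shows "ck k S h"
proof (cases k)
  case 0
  then show ?thesis using assms continuous_on_cong[of S S g h] by auto
next
  case (Suc l)
  then obtain a b where ab: "has_differential g (a, b) S" "ck l S a" "ck l S b"
    using assms by auto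
  have "has_differential h (a, b) S"
    by (rule has_differential_cong[OF assms(1) ab(1)]) (simp_all add: assms(3))
  then show ?thesis using ab Suc by (auto intro: ck_SucI)
qed

lemma has_differential_continuous_on:
  "has_differential g \<omega> S \<Longrightarrow> continuous_on S g"
  unfolding has_differential_def
  by (meson continuous_at_imp_continuous_on has_derivative_continuous)

lemma ck_Suc_imp: "ck (Suc k) S g \<Longrightarrow> ck k S g"
proof (induction k arbitrary: g)
  case 0
  then show ?case using has_differential_continuous_on by auto
next
  case (Suc k)
  then obtain a b where ab: "has_differential g (a, b) S" "ck (Suc k) S a" "ck (Suc k) S b"
    unfolding ck.simps(2)[of "Suc k"] by blast
  show ?case by (rule ck_SucI[OF ab(1)]) (intro Suc.IH ab)+
qed

lemma ck_imp_continuous_on: "ck k S g \<Longrightarrow> continuous_on S g"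
proof (induction k)
  case (Suc k)
  from Suc.IH[OF ck_Suc_imp[OF Suc.prems]] show ?case .
qed simp

lemma ck_SucD:
  assumes "open S" "ck (Suc k) S g"
  shows "has_differential g (pd 1 g, pd 2 g) S" "ck k S (pd 1 g)" "ck k S (pd 2 g)"
proof -
  obtain a b where ab: "has_differential g (a, b) S" "ck k S a" "ck k S b"
    using assms by auto
  note pd = has_differential_pd[OF ab(1)]
  show "has_differential g (pd 1 g, pd 2 g) S"
    by (rule has_differential_cong[OF assms(1) ab(1)]) (simp_all add: pd)
  show "ck k S (pd 1 g)" by (rule ck_cong[OF assms(1) ab(2)]) (simp add: pd)
  show "ck k S (pd 2 g)" by (rule ck_cong[OF assms(1) ab(3)]) (simp add: pd)
qed

section \<open>Iterated partial derivatives versus the classes C^k\<close>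

lemma iter_pd_append: "iter_pd (xs @ ys) g = iter_pd xs (iter_pd ys g)"
  by (induction xs) auto

lemma smooth_on_pd: "smooth_on S g \<Longrightarrow> smooth_on S (pd i g)"
  unfolding smooth_on_def
proof (intro allI)
  fix xs :: "'a list"
  assume "\<forall>is. \<forall>z\<in>S. continuous (at z) (iter_pd is g) \<and>
      (\<forall>i. (\<lambda>t. iter_pd is g (z + t *\<^sub>R axis i 1)) differentiable at 0)"
  \<comment> \<open>\<open>iter_pd\<close> applies the head of the list last, so an innermost
    derivative is appended at the end.\<close>
  from spec[OF this, of "xs @ [i]"]
  show "\<forall>z\<in>S. continuous (at z) (iter_pd xs (pd i g)) \<and>
      (\<forall>ia. (\<lambda>t. iter_pd xs (pd i g) (z + t *\<^sub>R axis ia 1)) differentiable at 0)"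
    by (simp add: iter_pd_append)
qed

lemma smooth_onD:
  assumes "smooth_on S g" "z \<in> S"
  shows "continuous (at z) g" "(\<lambda>t. g (z + t *\<^sub>R axis i 1)) differentiable (at 0)"
proof -
  have "\<forall>z\<in>S. continuous (at z) (iter_pd [] g) \<and>
      (\<forall>i. (\<lambda>t. iter_pd [] g (z + t *\<^sub>R axis i 1)) differentiable at 0)"
    using assms(1) unfolding smooth_on_def by (rule spec)
  then show "continuous (at z) g" "(\<lambda>t. g (z + t *\<^sub>R axis i 1)) differentiable (at 0)"
    using assms(2) by auto
qed

text \<open>Each partial derivative is smooth again, and its continuity turns differentiability
  along coordinate lines into a total differential; hence the induction generalizes over
  \<open>g\<close>.\<close>

lemma smooth_on_imp_ck:
  assumes "open S" "smooth_on S g"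
  shows "ck k S g"
  using assms(2)
proof (induction k arbitrary: g)
  have cont: "continuous_on S g" if "smooth_on S g" for g
    using smooth_onD(1)[OF that] by (simp add: continuous_at_imp_continuous_on)
  {
    case 0
    then show ?case using cont by simp
  next
    case (Suc k)
    have "((\<lambda>t. g (w + t *\<^sub>R axis i 1)) has_real_derivative pd i g w) (at 0)" if "w \<in> S" for w i
      unfolding pd_def using smooth_onD(2)[OF Suc.prems that] DERIV_deriv_iff_real_differentiable by blast
    then have "has_differential g (pd 1 g, pd 2 g) S"
      using cont[OF smooth_on_pd[OF Suc.prems]] by (intro has_differential_of_partials[OF assms(1)]) auto
    then show ?case using Suc.IH smooth_on_pd[OF Suc.prems] by auto
  }
qed

lemma smooth_on_iff_ck:
  assumes "open S"
  shows "smooth_on S g \<longleftrightarrow> (\<forall>k. ck k S g)"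
proof
  assume ck: "\<forall>k. ck k S g"
  have all: "\<forall>k. ck k S (iter_pd is g)" for "is"
  proof (induction "is")
    case (Cons i "is")
    then have "ck k S (pd i (iter_pd is g))" for k
      using ck_SucD[OF assms, of k "iter_pd is g"] exhaust_2[of i] by auto
    then show ?case by simp
  qed (use ck in simp)
  show "smooth_on S g"
    unfolding smooth_on_def
  proof (intro allI ballI conjI)
    fix xs z i assume z: "z \<in> S"
    have 1: "ck (Suc 0) S (iter_pd xs g)" using all by blast
    show "continuous (at z) (iter_pd xs g)"
      using ck_imp_continuous_on[OF 1] z assms by (simp add: continuous_on_eq_continuous_at)
    show "(\<lambda>t. iter_pd xs g (z + t *\<^sub>R axis i 1)) differentiable at 0"
      using partial_differentiable[OF has_differentialD[OF ck_SucD(1)[OF assms 1] z]] .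
  qed
qed (use smooth_on_imp_ck assms in blast)

section \<open>Closure of C^k under algebra, composition, inverse and square root\<close>

lemma has_differential_const: "has_differential (\<lambda>z. c) (\<lambda>z. 0, \<lambda>z. 0) S"
  by (auto simp: has_differential_def intro!: derivative_eq_intros)

lemma ck_const: "ck k S (\<lambda>z. c)"
proof (induction k arbitrary: c)
  case (Suc k)
  show ?case by (rule ck_SucI[OF has_differential_const]) (rule Suc.IH)+
qed simp

lemma ck_nth: "ck k S (\<lambda>z. z $ i)"
proof (cases k)
  case (Suc l)
  have "has_differential (\<lambda>z. z $ i) (\<lambda>z. if i = 1 then 1 else 0, \<lambda>z. if i = 2 then 1 else 0) S"
    using exhaust_2[of i] bounded_linear.has_derivative[OF bounded_linear_vec_nth has_derivative_ident]
    by (auto simp: has_differential_def)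
  then show ?thesis unfolding Suc by (rule ck_SucI) (intro ck_const)+
qed (auto intro!: continuous_intros)

lemma has_differential_add:
  "has_differential f (a, b) S \<Longrightarrow> has_differential g (c, d) S \<Longrightarrow>
    has_differential (\<lambda>z. f z + g z) (\<lambda>z. a z + c z, \<lambda>z. b z + d z) S"
  unfolding has_differential_def fst_conv snd_conv
  by (auto elim!: bspec intro!: has_derivative_eq_rhs[OF has_derivative_add] simp: distrib_right)

lemma has_differential_mult:
  "has_differential f (a, b) S \<Longrightarrow> has_differential g (c, d) S \<Longrightarrow>
    has_differential (\<lambda>z. f z * g z) (\<lambda>z. a z * g z + f z * c z, \<lambda>z. b z * g z + f z * d z) S"
  unfolding has_differential_def fst_conv snd_conv
  by (auto elim!: bspec intro!: has_derivative_eq_rhs[OF has_derivative_mult] simp: algebra_simps)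

lemma ck_add: "ck k S f \<Longrightarrow> ck k S g \<Longrightarrow> ck k S (\<lambda>z. f z + g z)"
proof (induction k arbitrary: f g)
  case (Suc k)
  then obtain a b c d where ab: "has_differential f (a, b) S" "ck k S a" "ck k S b"
    and cd: "has_differential g (c, d) S" "ck k S c" "ck k S d"
    by auto
  show ?case
    by (rule ck_SucI[OF has_differential_add[OF ab(1) cd(1)]]) (intro Suc.IH ab cd)+
qed (auto intro: continuous_intros)

lemma ck_mult: "ck k S f \<Longrightarrow> ck k S g \<Longrightarrow> ck k S (\<lambda>z. f z * g z)"
proof (induction k arbitrary: f g)
  case (Suc k)
  obtain a b c d where ab: "has_differential f (a, b) S" "ck k S a" "ck k S b"
    and cd: "has_differential g (c, d) S" "ck k S c" "ck k S d"
    using Suc.prems by auto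
  \<comment> \<open>The Leibniz coefficients contain \<open>f\<close> and \<open>g\<close>
    themselves, which are used here one order lower.\<close>
  have "ck k S f" "ck k S g" using Suc.prems ck_Suc_imp by blast+
  then have "ck k S (\<lambda>z. a z * g z + f z * c z)" "ck k S (\<lambda>z. b z * g z + f z * d z)"
    using ab cd Suc.IH by (auto intro!: ck_add)
  then show ?case using has_differential_mult[OF ab(1) cd(1)] by auto
qed (auto intro: continuous_intros)

lemma ck_compose:
  assumes "ck k T g" "ck k S (\<lambda>z. F z $ 1)" "ck k S (\<lambda>z. F z $ 2)" "\<And>z. z \<in> S \<Longrightarrow> F z \<in> T"
  shows "ck k S (\<lambda>z. g (F z))"
  using assms(1-3)
proof (induction k arbitrary: g)
  case 0
  have "continuous_on S (\<lambda>z. pt (F z $ 1) (F z $ 2))"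
    using 0 by (intro continuous_on_pt) auto
  then show ?case using 0 assms(4) by (auto intro!: continuous_on_compose2[of T g] simp del: continuous_on_componentwise)
next
  case (Suc k)
  obtain a b where g: "has_differential g (a, b) T" "ck k T a" "ck k T b"
    using Suc.prems by auto
  obtain a1 b1 where 1: "has_differential (\<lambda>z. F z $ 1) (a1, b1) S" "ck k S a1" "ck k S b1"
    using Suc.prems by auto
  obtain a2 b2 where 2: "has_differential (\<lambda>z. F z $ 2) (a2, b2) S" "ck k S a2" "ck k S b2"
    using Suc.prems by auto
  have F: "ck k S (\<lambda>z. F z $ 1)" "ck k S (\<lambda>z. F z $ 2)"
    using Suc.prems ck_Suc_imp by blast+
  have ab: "ck k S (\<lambda>z. a (F z))" "ck k S (\<lambda>z. b (F z))"
    using Suc.IH g F by blast+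
  have "has_differential (\<lambda>z. g (F z))
      (\<lambda>z. a (F z) * a1 z + b (F z) * a2 z, \<lambda>z. a (F z) * b1 z + b (F z) * b2 z) S"
    unfolding has_differential_def fst_conv snd_conv
  proof
    fix z assume z: "z \<in> S"
    have "((\<lambda>z. pt (F z $ 1) (F z $ 2)) has_derivative
        (\<lambda>v. pt (a1 z * v $ 1 + b1 z * v $ 2) (a2 z * v $ 1 + b2 z * v $ 2))) (at z)"
      by (intro has_derivative_pt has_differentialD[OF 1(1) z] has_differentialD[OF 2(1) z])
    then have "(F has_derivative
        (\<lambda>v. pt (a1 z * v $ 1 + b1 z * v $ 2) (a2 z * v $ 1 + b2 z * v $ 2))) (at z)"
      by simp
    from has_derivative_compose[OF this has_differentialD[OF g(1) assms(4)[OF z]]]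
    show "((\<lambda>z. g (F z)) has_derivative (\<lambda>v. (a (F z) * a1 z + b (F z) * a2 z) * v $ 1 +
        (a (F z) * b1 z + b (F z) * b2 z) * v $ 2)) (at z)"
      by (simp add: algebra_simps)
  qed
  then show ?case by (rule ck_SucI) (intro ck_add ck_mult ab 1 2)+
qed

text \<open>The differential of 1/g is a polynomial in 1/g and the derivatives of g, so order k of
  1/g yields order k + 1. \<open>ck_sqrt\<close> bootstraps in the same way on top of this
  lemma.\<close>

lemma ck_inverse:
  assumes "ck k S g" "\<And>z. z \<in> S \<Longrightarrow> g z \<noteq> 0"
  shows "ck k S (\<lambda>z. inverse (g z))"
  using assms(1)
proof (induction k)
  case 0
  then show ?case using assms(2) by (auto intro!: continuous_intros)
next
  case (Suc k)
  obtain a b where g: "has_differential g (a, b) S" "ck k S a" "ck k S b"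
    using Suc.prems by auto
  have i: "ck k S (\<lambda>z. inverse (g z))" using Suc ck_Suc_imp by blast
  \<comment> \<open>The minus sign is written as a factor -1 so that \<open>ck_const\<close> and
    \<open>ck_mult\<close> cover the coefficients.\<close>
  have "has_differential (\<lambda>z. inverse (g z))
      (\<lambda>z. -1 * (a z * (inverse (g z) * inverse (g z))), \<lambda>z. -1 * (b z * (inverse (g z) * inverse (g z)))) S"
    unfolding has_differential_def fst_conv snd_conv
    by (auto intro!: has_derivative_eq_rhs[OF Deriv.has_derivative_inverse] has_differentialD[OF g(1)] assms(2)
        simp: algebra_simps)
  then show ?case by (rule ck_SucI) (intro ck_mult ck_const g i)+
qed

lemma ck_sqrt:
  assumes "ck k S g" "\<And>z. z \<in> S \<Longrightarrow> g z > 0"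
  shows "ck k S (\<lambda>z. sqrt (g z))"
  using assms(1)
proof (induction k)
  case 0
  then show ?case by (auto intro!: continuous_intros)
next
  case (Suc k)
  obtain a b where g: "has_differential g (a, b) S" "ck k S a" "ck k S b"
    using Suc.prems by auto
  have "ck k S (\<lambda>z. sqrt (g z))" using Suc ck_Suc_imp by blast
  moreover have "sqrt (g z) \<noteq> 0" if "z \<in> S" for z using assms(2)[OF that] by simp
  ultimately have i: "ck k S (\<lambda>z. inverse (sqrt (g z)))" by (rule ck_inverse)
  have "((\<lambda>z. sqrt (g z)) has_derivative (\<lambda>v. 1/2 * (a z * inverse (sqrt (g z))) * v $ 1 +
      1/2 * (b z * inverse (sqrt (g z))) * v $ 2)) (at z)" if z: "z \<in> S" for z
    by (rule has_derivative_eq_rhs[OF has_derivative_real_sqrt[OF assms(2)[OF z] has_differentialD[OF g(1) z]]])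
      (auto simp: field_simps fun_eq_iff add_divide_distrib)
  then have "has_differential (\<lambda>z. sqrt (g z))
      (\<lambda>z. 1/2 * (a z * inverse (sqrt (g z))), \<lambda>z. 1/2 * (b z * inverse (sqrt (g z)))) S"
    by (simp add: has_differential_def)
  then show ?case by (rule ck_SucI) (intro ck_mult ck_const g i)+
qed

lemma smooth_on_cong:
  "open S \<Longrightarrow> smooth_on S g \<Longrightarrow> (\<And>z. z \<in> S \<Longrightarrow> g z = h z) \<Longrightarrow> smooth_on S (h :: real^2 \<Rightarrow> real)"
  by (meson ck_cong smooth_on_iff_ck)

lemma smooth_on_subset: "smooth_on S g \<Longrightarrow> T \<subseteq> S \<Longrightarrow> smooth_on T g"
  by (auto simp: smooth_on_def)

lemma smooth_on_const: "open S \<Longrightarrow> smooth_on S (\<lambda>z :: real^2. c)"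
  by (simp add: smooth_on_iff_ck ck_const)

lemma smooth_on_nth: "open S \<Longrightarrow> smooth_on S (\<lambda>z :: real^2. z $ i)"
  by (simp add: smooth_on_iff_ck ck_nth)

lemma smooth_on_add:
  "open S \<Longrightarrow> smooth_on S f \<Longrightarrow> smooth_on S g \<Longrightarrow> smooth_on S (\<lambda>z :: real^2. f z + g z)"
  by (simp add: smooth_on_iff_ck ck_add)

lemma smooth_on_mult:
  "open S \<Longrightarrow> smooth_on S f \<Longrightarrow> smooth_on S g \<Longrightarrow> smooth_on S (\<lambda>z :: real^2. f z * g z)"
  by (simp add: smooth_on_iff_ck ck_mult)

lemma smooth_on_minus:
  "open S \<Longrightarrow> smooth_on S f \<Longrightarrow> smooth_on S (\<lambda>z :: real^2. - f z)"
  using smooth_on_mult[OF _ smooth_on_const[of S "-1"]] by simp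

lemma smooth_on_diff:
  "open S \<Longrightarrow> smooth_on S f \<Longrightarrow> smooth_on S g \<Longrightarrow> smooth_on S (\<lambda>z :: real^2. f z - g z)"
  using smooth_on_add[OF _ _ smooth_on_minus] by simp

lemma smooth_on_inverse:
  "open S \<Longrightarrow> smooth_on S g \<Longrightarrow> (\<And>z. z \<in> S \<Longrightarrow> g z \<noteq> 0) \<Longrightarrow> smooth_on S (\<lambda>z :: real^2. inverse (g z))"
  by (simp add: smooth_on_iff_ck ck_inverse)

lemma smooth_on_sqrt:
  "open S \<Longrightarrow> smooth_on S g \<Longrightarrow> (\<And>z. z \<in> S \<Longrightarrow> g z > 0) \<Longrightarrow> smooth_on S (\<lambda>z :: real^2. sqrt (g z))"
  by (simp add: smooth_on_iff_ck ck_sqrt)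

lemma smooth_on_compose:
  fixes F :: "real^2 \<Rightarrow> real^2"
  assumes "open S" "open T" "smooth_on T g" "\<And>i. smooth_on S (\<lambda>z. F z $ i)" "\<And>z. z \<in> S \<Longrightarrow> F z \<in> T"
  shows "smooth_on S (\<lambda>z. g (F z))"
  unfolding smooth_on_iff_ck[OF assms(1)]
  using ck_compose[OF smooth_on_imp_ck[OF assms(2,3)] smooth_on_imp_ck[OF assms(1,4)]
      smooth_on_imp_ck[OF assms(1,4)] assms(5)] by blast

lemmas smooth_on_intros = smooth_on_const smooth_on_nth smooth_on_add smooth_on_mult smooth_on_minus
  smooth_on_diff smooth_on_inverse smooth_on_sqrt smooth_on_pd

lemma smooth_on_differential:
  "open S \<Longrightarrow> smooth_on S g \<Longrightarrow> has_differential g (pd 1 g, pd 2 g) S"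
  by (rule ck_SucD(1)[OF _ smooth_on_imp_ck[where k = "Suc 0"]])

lemma smooth_on_has_derivative:
  "open S \<Longrightarrow> smooth_on S g \<Longrightarrow> (z :: real^2) \<in> S \<Longrightarrow> (g has_derivative (\<lambda>v. pd 1 g z * v $ 1 + pd 2 g z * v $ 2)) (at z)"
  by (rule has_differentialD[OF smooth_on_differential])

lemma smooth_on_continuous_on: "open S \<Longrightarrow> smooth_on S g \<Longrightarrow> continuous_on S (g :: real^2 \<Rightarrow> real)"
  using smooth_on_imp_ck[where k = 0] by simp

lemma smooth_onI_differential:
  assumes "open S" "has_differential g (a, b) S" "smooth_on S a" "smooth_on S b"
  shows "smooth_on S g"
  unfolding smooth_on_iff_ck[OF assms(1)]
proof
  fix k
  have "ck (Suc k) S g"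
    using assms by (auto simp: smooth_on_iff_ck intro: ck_SucI)
  then show "ck k S g" by (rule ck_Suc_imp)
qed

section \<open>Calculus rules for partial derivatives of smooth functions\<close>

lemma pd_add:
  fixes z :: "real^2"
  assumes "open S" "smooth_on S f" "smooth_on S g" "z \<in> S"
  shows "pd i (\<lambda>z. f z + g z) z = pd i f z + pd i g z"
  using has_differential_pd[OF has_differential_add[OF smooth_on_differential[OF assms(1,2)]
        smooth_on_differential[OF assms(1,3)]] assms(4)] exhaust_2[of i] by auto

lemma pd_mult:
  fixes z :: "real^2"
  assumes "open S" "smooth_on S f" "smooth_on S g" "z \<in> S"
  shows "pd i (\<lambda>z. f z * g z) z = pd i f z * g z + f z * pd i g z"
  using has_differential_pd[OF has_differential_mult[OF smooth_on_differential[OF assms(1,2)]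
        smooth_on_differential[OF assms(1,3)]] assms(4)] exhaust_2[of i] by auto

lemma pd_const [simp]: "pd i (\<lambda>z. c) z = 0"
  by (simp add: pd_def)

lemma pd_minus:
  fixes z :: "real^2"
  assumes "open S" "smooth_on S f" "z \<in> S"
  shows "pd i (\<lambda>z. - f z) z = - pd i f z"
  using pd_mult[OF assms(1) smooth_on_const[OF assms(1), of "-1"] assms(2,3)] by simp

lemma pd_nth: "pd i (\<lambda>z :: real^2. z $ j) z = (if i = j then 1 else 0)"
proof -
  have "((\<lambda>z. z $ j) has_derivative (\<lambda>v. (if j = 1 then 1 else 0) * v $ 1 + (if j = 2 then 1 else 0) * v $ 2)) (at z)"
    using exhaust_2[of j] bounded_linear.has_derivative[OF bounded_linear_vec_nth has_derivative_ident] by auto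
  from pd_eqI[OF this] show ?thesis using exhaust_2[of j] exhaust_2[of i] by auto
qed

lemma has_derivative_plane_map:
  fixes F :: "real^2 \<Rightarrow> real^2"
  assumes "open S" "\<And>i. smooth_on S (\<lambda>z. F z $ i)" "z \<in> S"
  shows "(F has_derivative (\<lambda>v. pt (pd 1 (\<lambda>z. F z $ 1) z * v $ 1 + pd 2 (\<lambda>z. F z $ 1) z * v $ 2)
      (pd 1 (\<lambda>z. F z $ 2) z * v $ 1 + pd 2 (\<lambda>z. F z $ 2) z * v $ 2))) (at z)"
proof -
  have "((\<lambda>z. pt (F z $ 1) (F z $ 2)) has_derivative
     (\<lambda>v. pt (pd 1 (\<lambda>z. F z $ 1) z * v $ 1 + pd 2 (\<lambda>z. F z $ 1) z * v $ 2)
      (pd 1 (\<lambda>z. F z $ 2) z * v $ 1 + pd 2 (\<lambda>z. F z $ 2) z * v $ 2))) (at z)"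
    by (intro has_derivative_pt smooth_on_has_derivative[OF assms(1)] assms)
  then show ?thesis by simp
qed

lemma pd_compose:
  fixes F :: "real^2 \<Rightarrow> real^2"
  assumes "open S" "\<And>i. smooth_on S (\<lambda>z. F z $ i)" "z \<in> S"
    and g: "(g has_derivative (\<lambda>v. a * v $ 1 + b * v $ 2)) (at (F z))"
  shows "pd i (\<lambda>z. g (F z)) z = a * pd i (\<lambda>z. F z $ 1) z + b * pd i (\<lambda>z. F z $ 2) z"
proof -
  let ?a = "\<lambda>i. a * pd i (\<lambda>z. F z $ 1) z + b * pd i (\<lambda>z. F z $ 2) z"
  have "((\<lambda>z. g (F z)) has_derivative (\<lambda>v. ?a 1 * v $ 1 + ?a 2 * v $ 2)) (at z)"
    using has_derivative_compose[OF has_derivative_plane_map[OF assms(1-3)] g] by (simp add: algebra_simps)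
  from pd_eqI[OF this] show ?thesis using exhaust_2[of i] by auto
qed

lemma has_differential_compose_real:
  assumes "has_differential g (a, b) S" "\<And>z. z \<in> S \<Longrightarrow> (\<phi> has_real_derivative \<phi>' z) (at (g z))"
  shows "has_differential (\<lambda>z. \<phi> (g z)) (\<lambda>z. \<phi>' z * a z, \<lambda>z. \<phi>' z * b z) S"
  unfolding has_differential_def fst_conv snd_conv
proof
  fix z assume z: "z \<in> S"
  show "((\<lambda>z. \<phi> (g z)) has_derivative (\<lambda>v. \<phi>' z * a z * v $ 1 + \<phi>' z * b z * v $ 2)) (at z)"
    using has_derivative_compose[OF has_differentialD[OF assms(1) z]
        assms(2)[OF z, unfolded has_field_derivative_def]]
    by (simp add: algebra_simps)
qed

lemma smooth1_on_deriv: "smooth1_on T \<phi> \<Longrightarrow> smooth1_on T (deriv \<phi>)"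
  unfolding smooth1_on_def by (metis comp_apply funpow_Suc_right)

lemma smooth1_on_DERIV: "smooth1_on T \<phi> \<Longrightarrow> x \<in> T \<Longrightarrow> (\<phi> has_real_derivative deriv \<phi> x) (at x)"
  unfolding smooth1_on_def DERIV_deriv_iff_real_differentiable by (metis funpow_0)

text \<open>The differential of \<open>\<phi> \<circ> g\<close> contains \<open>deriv \<phi>\<close>
  in place of \<open>\<phi>\<close>, so the induction on the order generalizes over
  \<open>\<phi>\<close>.\<close>

lemma smooth_on_smooth1_compose:
  assumes "open S" "smooth_on S g" "smooth1_on T \<phi>" "\<And>z. z \<in> S \<Longrightarrow> g z \<in> T"
  shows "smooth_on S (\<lambda>z :: real^2. \<phi> (g z))"
  unfolding smooth_on_iff_ck[OF assms(1)]
proof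
  fix k
  show "ck k S (\<lambda>z. \<phi> (g z))"
    using assms(3)
  proof (induction k arbitrary: \<phi>)
    case (Suc k)
    note d = has_differential_compose_real[OF smooth_on_differential[OF assms(1,2)]
        smooth1_on_DERIV[OF Suc.prems assms(4)]]
    have "smooth_on S (pd i g)" for i using assms by (intro smooth_on_pd)
    then show ?case
      by (intro ck_SucI[OF d] ck_mult Suc.IH smooth1_on_deriv Suc.prems smooth_on_imp_ck[OF assms(1)])
  next
    case 0
    have "continuous_on T \<phi>"
      using smooth1_on_DERIV[OF 0] by (meson DERIV_isCont continuous_at_imp_continuous_on)
    then show ?case
      using smooth_on_continuous_on[OF assms(1,2)] assms(4) by (auto intro: continuous_on_compose2)
  qed
qed

section \<open>Symmetry of mixed partials and primitives of closed forms\<close>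

text \<open>Differentiation under the integral sign; it drives both the symmetry of mixed partials
  and the construction of primitives.\<close>

lemma partial_integral_has_derivative:
  assumes S: "open S" and box: "\<And>x y. x \<in> X \<Longrightarrow> y \<in> {c..d} \<Longrightarrow> pt x y \<in> S"
    and X: "open X" "convex X" "x \<in> X"
    and b: "has_differential b (bx, by) S" and bx: "continuous_on S bx"
  shows "((\<lambda>x. integral {c..d} (\<lambda>t. b (pt x t))) has_real_derivative
      integral {c..d} (\<lambda>t. bx (pt x t))) (at x)"
proof -
  have "((\<lambda>x. integral (cbox c d) (\<lambda>t. b (pt x t))) has_real_derivative
      integral (cbox c d) (\<lambda>t. bx (pt x t))) (at x within X)"
  proof (rule leibniz_rule_field_derivative[OF _ _ _ X(3,2)])
    fix x t assume "x \<in> X" "t \<in> cbox c d"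
    then have "pt x t \<in> S" using box by auto
    from has_derivative_partial_derivs(1)[OF has_differentialD[OF b this]]
    have "((\<lambda>s. b (pt s t)) has_real_derivative bx (pt x t)) (at (0 + x))"
      by (subst DERIV_shift) (simp add: add_axis_pt add.commute)
    then show "((\<lambda>s. b (pt s t)) has_real_derivative bx (pt x t)) (at x within X)"
      by (simp add: has_field_derivative_at_within)
  next
    fix x assume "x \<in> X"
    then have "continuous_on (cbox c d) (\<lambda>t. b (pt x t))"
      using box by (intro continuous_on_compose2[OF has_differential_continuous_on[OF b]])
        (auto intro!: continuous_intros)
    then show "(\<lambda>t. b (pt x t)) integrable_on cbox c d" by (rule integrable_continuous)
  next
    show "continuous_on (X \<times> cbox c d) (\<lambda>(x, t). bx (pt x t))"
      unfolding split_beta using box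
      by (intro continuous_on_compose2[OF bx]) (auto intro!: continuous_intros)
  qed
  then show ?thesis using X at_within_open[of x X] by simp
qed

lemma square_in_open:
  assumes "open S" "z \<in> S"
  obtains e where "e > 0" "\<And>x y. \<bar>x - z $ 1\<bar> \<le> e \<Longrightarrow> \<bar>y - z $ 2\<bar> \<le> e \<Longrightarrow> pt x y \<in> S"
proof -
  obtain e where e: "e > 0" "ball z e \<subseteq> S" using assms openE by blast
  \<comment> \<open>A third of the radius, so that the bound 2 e / 3 stays below e even on the
    boundary of the closed square.\<close>
  have "pt x y \<in> S" if "\<bar>x - z $ 1\<bar> \<le> e / 3" "\<bar>y - z $ 2\<bar> \<le> e / 3" for x y
  proof -
    have "dist (pt x y) z < e" using dist_pt_le[of x y z] that e(1) by linarith
    then show ?thesis using e(2) by (auto simp: dist_commute)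
  qed
  then show ?thesis using that[of "e / 3"] e(1) by simp
qed

text \<open>Write \<open>g(x, y) - g(x, c)\<close> as the integral of \<open>b\<close> over a
  vertical segment. Differentiating in x under the integral gives \<open>a(x, y) - a(x, c)\<close>
  as the integral of \<open>bx\<close>; differentiating that in y gives the claim.\<close>

lemma mixed_partials_eq:
  assumes S: "open S" "z \<in> S"
    and g: "has_differential g (a, b) S"
    and a: "has_differential a (ax, ay) S"
    and b: "has_differential b (bx, by) S"
    and cont: "continuous_on S bx"
  shows "ay z = bx z"
proof -
  obtain e where e: "e > 0" "\<And>x y. \<bar>x - z $ 1\<bar> \<le> e \<Longrightarrow> \<bar>y - z $ 2\<bar> \<le> e \<Longrightarrow> pt x y \<in> S"
    using square_in_open[OF S] by metis
  define c where "c = z $ 2 - e"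
  define d where "d = z $ 2 + e"
  define X where "X = {z $ 1 - e <..< z $ 1 + e}"
  have inS: "pt x y \<in> S" if "x \<in> X" "y \<in> {c..d}" for x y
    using that by (intro e(2)) (auto simp: X_def c_def d_def)
  have zX: "z $ 1 \<in> X" "z $ 2 \<in> {c<..<d}" using e(1) by (auto simp: X_def c_def d_def)
  have X: "open X" "convex X" by (auto simp: X_def)
  have dx: "((\<lambda>s. h (pt s y)) has_real_derivative p (pt x y)) (at x)"
    if "has_differential h (p, q) S" "x \<in> X" "y \<in> {c..d}" for h p q x y
  proof -
    have "((\<lambda>s. h (pt s y)) has_real_derivative p (pt x y)) (at (0 + x))"
      using has_derivative_partial_derivs(1)[OF has_differentialD[OF that(1) inS[OF that(2,3)]]]
      by (subst DERIV_shift) (simp add: add_axis_pt add.commute)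
    then show ?thesis by simp
  qed
  have dy: "((\<lambda>s. h (pt x s)) has_real_derivative q (pt x y)) (at y)"
    if "has_differential h (p, q) S" "x \<in> X" "y \<in> {c..d}" for h p q x y
  proof -
    have "((\<lambda>s. h (pt x s)) has_real_derivative q (pt x y)) (at (0 + y))"
      using has_derivative_partial_derivs(2)[OF has_differentialD[OF that(1) inS[OF that(2,3)]]]
      by (subst DERIV_shift) (simp add: add_axis_pt add.commute)
    then show ?thesis by simp
  qed
  have ftc: "integral {c..y} (\<lambda>t. b (pt x t)) = g (pt x y) - g (pt x c)"
    if "x \<in> X" "y \<in> {c..d}" for x y
    using that dy[OF g that(1)]
    by (intro integral_unique fundamental_theorem_of_calculus)
      (auto simp: has_real_derivative_iff_has_vector_derivative[symmetric] intro: has_field_derivative_at_within)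
  have A: "a (pt (z $ 1) y) - a (pt (z $ 1) c) = integral {c..y} (\<lambda>t. bx (pt (z $ 1) t))"
    if y: "y \<in> {c..d}" for y
  proof -
    have 1: "((\<lambda>x. integral {c..y} (\<lambda>t. b (pt x t))) has_real_derivative
      integral {c..y} (\<lambda>t. bx (pt (z $ 1) t))) (at (z $ 1))"
      using partial_integral_has_derivative[OF S(1) _ X zX(1) b cont, of c y] inS y by auto
    have "((\<lambda>x. g (pt x y) - g (pt x c)) has_real_derivative a (pt (z $ 1) y) - a (pt (z $ 1) c)) (at (z $ 1))"
      using y by (intro DERIV_diff dx[OF g zX(1)]) auto
    then have 2: "((\<lambda>x. integral {c..y} (\<lambda>t. b (pt x t))) has_real_derivative
        a (pt (z $ 1) y) - a (pt (z $ 1) c)) (at (z $ 1))"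
      by (rule has_field_derivative_transform_within_open[OF _ X(1) zX(1)]) (simp add: ftc[OF _ y])
    from DERIV_unique[OF 2 1] show ?thesis .
  qed
  have "continuous_on {c..d} (\<lambda>t. bx (pt (z $ 1) t))"
    using inS zX by (intro continuous_on_compose2[OF cont]) (auto intro!: continuous_intros)
  then have "((\<lambda>y. integral {c..y} (\<lambda>t. bx (pt (z $ 1) t))) has_real_derivative bx z) (at (z $ 2) within {c..d})"
    using integral_has_real_derivative[of c d "\<lambda>t. bx (pt (z $ 1) t)" "z $ 2"] zX by auto
  then have 1: "((\<lambda>y. integral {c..y} (\<lambda>t. bx (pt (z $ 1) t))) has_real_derivative bx z) (at (z $ 2))"
    using zX at_within_interior[of "z $ 2" "{c..d}"] by auto
  have "((\<lambda>y. a (pt (z $ 1) y) - a (pt (z $ 1) c)) has_real_derivative ay z - 0) (at (z $ 2))"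
    using dy[OF a zX(1), of "z $ 2"] zX by (intro DERIV_diff DERIV_const) auto
  then have 2: "((\<lambda>y. integral {c..y} (\<lambda>t. bx (pt (z $ 1) t))) has_real_derivative ay z - 0) (at (z $ 2))"
    by (rule has_field_derivative_transform_within_open[of _ _ _ "{c<..<d}"]) (use A zX in auto)
  from DERIV_unique[OF 2 1] show ?thesis by simp
qed

lemma pd_commute:
  fixes z :: "real^2"
  assumes "open S" "smooth_on S g" "z \<in> S"
  shows "pd 2 (pd 1 g) z = pd 1 (pd 2 g) z"
  by (rule mixed_partials_eq[OF assms(1,3) smooth_on_differential[OF assms(1,2)]
        smooth_on_differential[OF assms(1) smooth_on_pd[OF assms(2)]]
        smooth_on_differential[OF assms(1) smooth_on_pd[OF assms(2)]]
        smooth_on_continuous_on[OF assms(1) smooth_on_pd[OF smooth_on_pd[OF assms(2)]]]])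

text \<open>The primitive integrates along an L-shaped path from the lower left corner of a square
  around \<open>z\<close>. The result is stated on the inscribed ball; the path may leave the ball
  but not the square, which lies in \<open>S\<close>.\<close>

lemma closed_form_has_primitive:
  fixes z :: "real^2"
  assumes S: "open S" "z \<in> S"
    and a: "smooth_on S a" and b: "smooth_on S b"
    and eq: "\<And>w. w \<in> S \<Longrightarrow> pd 2 a w = pd 1 b w"
  obtains e and g :: "real^2 \<Rightarrow> real" where "e > 0" "ball z e \<subseteq> S" "has_differential g (a, b) (ball z e)" "smooth_on (ball z e) g"
proof -
  obtain e where e: "e > 0" "\<And>x y. \<bar>x - z $ 1\<bar> \<le> e \<Longrightarrow> \<bar>y - z $ 2\<bar> \<le> e \<Longrightarrow> pt x y \<in> S"
    using square_in_open[OF S] by metis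
  define c where "c = z $ 2 - e"
  define d where "d = z $ 2 + e"
  define c1 where "c1 = z $ 1 - e"
  define d1 where "d1 = z $ 1 + e"
  have inS: "pt x y \<in> S" if "x \<in> {c1..d1}" "y \<in> {c..d}" for x y
    using that by (intro e(2)) (auto simp: c1_def d1_def c_def d_def)
  have X: "open {c1<..<d1}" "convex {c1<..<d1}" by auto
  define g where "g = (\<lambda>w :: real^2. integral {c1..w $ 1} (\<lambda>s. a (pt s c)) + integral {c..w $ 2} (\<lambda>t. b (pt (w $ 1) t)))"
  have conta: "continuous_on S a" and contb: "continuous_on S b" and contbx: "continuous_on S (pd 1 b)"
    using a b S(1) by (auto intro!: smooth_on_continuous_on smooth_on_pd)
  have inbox: "w $ 1 \<in> {c1<..<d1}" "w $ 2 \<in> {c<..<d}" if "w \<in> ball z e" for w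
  proof -
    have "\<bar>w $ i - z $ i\<bar> < e" for i
      using that component_le_norm_cart[of "w - z" i] by (simp add: dist_norm norm_minus_commute)
    from this[of 1] this[of 2] show "w $ 1 \<in> {c1<..<d1}" "w $ 2 \<in> {c<..<d}"
      by (auto simp: c1_def d1_def c_def d_def)
  qed
  have ball: "ball z e \<subseteq> S"
  proof
    fix w assume "w \<in> ball z e"
    then show "w \<in> S" using inS[of "w $ 1" "w $ 2"] inbox[of w] by auto
  qed
  have "has_differential g (a, b) (ball z e)"
  proof (rule has_differential_of_partials)
    fix w assume w: "w \<in> ball z e"
    note wb = inbox[OF w]
    have 1: "((\<lambda>x. integral {c1..x} (\<lambda>s. a (pt s c))) has_real_derivative a (pt (w $ 1) c)) (at (w $ 1))"
    proof -
      have "continuous_on {c1..d1} (\<lambda>s. a (pt s c))"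
        using inS wb by (intro continuous_on_compose2[OF conta]) (auto intro!: continuous_intros)
      from integral_has_real_derivative[OF this, of "w $ 1"]
      show ?thesis using wb at_within_interior[of "w $ 1" "{c1..d1}"] by auto
    qed
    have 2: "((\<lambda>x. integral {c..w $ 2} (\<lambda>t. b (pt x t))) has_real_derivative
        integral {c..w $ 2} (\<lambda>t. pd 1 b (pt (w $ 1) t))) (at (w $ 1))"
      using wb inS by (intro partial_integral_has_derivative[OF S(1) _ X _ smooth_on_differential[OF S(1) b] contbx]) auto
    \<comment> \<open>Closedness replaces the integrand by \<open>pd 2 a\<close>, so the integral
      telescopes, and its lower end cancels the derivative of the integral along the bottom
      edge.\<close>
    have 3: "integral {c..w $ 2} (\<lambda>t. pd 1 b (pt (w $ 1) t)) = a w - a (pt (w $ 1) c)"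
    proof -
      have "((\<lambda>t. pd 1 b (pt (w $ 1) t)) has_integral a (pt (w $ 1) (w $ 2)) - a (pt (w $ 1) c)) {c..w $ 2}"
      proof (rule fundamental_theorem_of_calculus)
        fix y assume y: "y \<in> {c..w $ 2}"
        then have pS: "pt (w $ 1) y \<in> S" using wb by (intro inS) auto
        have "((\<lambda>s. a (pt (w $ 1) s)) has_real_derivative pd 2 a (pt (w $ 1) y)) (at (0 + y))"
          using has_derivative_partial_derivs(2)[OF smooth_on_has_derivative[OF S(1) a pS]]
          by (subst DERIV_shift) (simp add: add_axis_pt add.commute)
        then show "((\<lambda>s. a (pt (w $ 1) s)) has_vector_derivative pd 1 b (pt (w $ 1) y)) (at y within {c..w $ 2})"
          using eq[OF pS]
          by (auto simp: has_real_derivative_iff_has_vector_derivative[symmetric] intro: has_field_derivative_at_within)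
      qed (use wb in auto)
      then show ?thesis by (simp add: integral_unique)
    qed
    have "((\<lambda>x. integral {c1..x} (\<lambda>s. a (pt s c)) + integral {c..w $ 2} (\<lambda>t. b (pt x t))) has_real_derivative
        a w) (at (0 + w $ 1))"
      using DERIV_add[OF 1 2] 3 by simp
    then show "((\<lambda>t. g (w + t *\<^sub>R axis 1 1)) has_real_derivative a w) (at 0)"
      by (subst (asm) DERIV_shift) (simp add: g_def add_axis_pt add.commute)
    have "continuous_on {c..d} (\<lambda>t. b (pt (w $ 1) t))"
      using inS wb by (intro continuous_on_compose2[OF contb]) (auto intro!: continuous_intros)
    from integral_has_real_derivative[OF this, of "w $ 2"]
    have "((\<lambda>y. integral {c..y} (\<lambda>t. b (pt (w $ 1) t))) has_real_derivative b w) (at (w $ 2))"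
      using wb at_within_interior[of "w $ 2" "{c..d}"] by auto
    then have "((\<lambda>y. integral {c1..w $ 1} (\<lambda>s. a (pt s c)) + integral {c..y} (\<lambda>t. b (pt (w $ 1) t)))
        has_real_derivative 0 + b w) (at (0 + w $ 2))"
      by (intro DERIV_add DERIV_const) simp
    then show "((\<lambda>t. g (w + t *\<^sub>R axis 2 1)) has_real_derivative b w) (at 0)"
      by (subst (asm) DERIV_shift) (simp add: g_def add_axis_pt add.commute)
  qed (use continuous_on_subset[OF contb ball] in auto)
  moreover from smooth_onI_differential[OF _ this smooth_on_subset[OF a ball] smooth_on_subset[OF b ball]]
  have "smooth_on (ball z e) g" by simp
  ultimately show ?thesis using that[OF e(1) ball] by blast
qed

section \<open>Smooth local inverses\<close>

text \<open>In (a) the target is the (x1, x2)-plane, and strict convexity of the constructed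
  \<open>u\<close> needs a convex domain there; hence the ball is taken in the target.\<close>

lemma homeomorphism_restrict_ball:
  fixes F :: "'a::euclidean_space \<Rightarrow> 'a"
  assumes "homeomorphism U V F G" "open U" "open V" "z \<in> U"
  obtains V' e where "open V'" "z \<in> V'" "V' \<subseteq> U" "e > 0" "ball (F z) e \<subseteq> V"
    "homeomorphism V' (ball (F z) e) F G"
proof -
  have "F z \<in> V" using assms by (auto simp: homeomorphism_def)
  then obtain e where e: "e > 0" "ball (F z) e \<subseteq> V" using assms(3) openE by blast
  define V' where "V' = U \<inter> F -` ball (F z) e"
  have "open V'"
    unfolding V'_def using assms by (intro continuous_open_preimage) (auto simp: homeomorphism_def)
  moreover have "F ` V' = ball (F z) e"
    using e assms(1) by (fastforce simp: V'_def homeomorphism_def image_iff)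
  then have "homeomorphism V' (ball (F z) e) F G"
    using homeomorphism_of_subsets[OF assms(1), of V' V] by (auto simp: V'_def)
  ultimately show ?thesis using that[of V' e] e assms(4) by (auto simp: V'_def)
qed

text \<open>Matrix units. The inverse function theorem asks for a derivative that is continuous as a
  map into bounded linear operators; as a combination of fixed operators it is continuous once its
  four coefficients are.\<close>

definition entry_blinfun :: "2 \<Rightarrow> 2 \<Rightarrow> (real^2) \<Rightarrow>\<^sub>L (real^2)" where
  "entry_blinfun i j = Blinfun (\<lambda>v. v $ j *\<^sub>R axis i 1)"

lemma entry_blinfun_apply [simp]: "blinfun_apply (entry_blinfun i j) v = v $ j *\<^sub>R axis i 1"
  unfolding entry_blinfun_def
  by (subst bounded_linear_Blinfun_apply)
    (auto intro: bounded_linear_compose[OF bounded_linear_scaleR_left bounded_linear_vec_nth])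

definition mat_blinfun :: "real \<Rightarrow> real \<Rightarrow> real \<Rightarrow> real \<Rightarrow> (real^2) \<Rightarrow>\<^sub>L (real^2)" where
  "mat_blinfun a b c d = a *\<^sub>R entry_blinfun 1 1 + b *\<^sub>R entry_blinfun 1 2
     + c *\<^sub>R entry_blinfun 2 1 + d *\<^sub>R entry_blinfun 2 2"

lemma mat_blinfun_apply:
  "blinfun_apply (mat_blinfun a b c d) v = pt (a * v $ 1 + b * v $ 2) (c * v $ 1 + d * v $ 2)"
  by (simp add: mat_blinfun_def blinfun.add_left blinfun.scaleR_left pt_def algebra_simps)

lemma mat_blinfun_adjugate:
  assumes "a * d - b * c \<noteq> 0"
  defines "k \<equiv> inverse (a * d - b * c)"
  shows "mat_blinfun (k * d) (- (k * b)) (- (k * c)) (k * a) o\<^sub>L mat_blinfun a b c d = id_blinfun"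
proof (rule blinfun_eqI)
  fix v :: "real^2"
  have k: "k * (a * d - b * c) = 1" using assms by simp
  have "k * d * (a * v $ 1 + b * v $ 2) + - (k * b) * (c * v $ 1 + d * v $ 2) = k * (a * d - b * c) * v $ 1"
    "- (k * c) * (a * v $ 1 + b * v $ 2) + k * a * (c * v $ 1 + d * v $ 2) = k * (a * d - b * c) * v $ 2"
    by (simp_all add: algebra_simps)
  then show "blinfun_apply (mat_blinfun (k * d) (- (k * b)) (- (k * c)) (k * a) o\<^sub>L mat_blinfun a b c d) v
      = blinfun_apply id_blinfun v"
    unfolding k by (simp add: mat_blinfun_apply)
qed

text \<open>Regularity is bootstrapped: the derivative of \<open>G\<close> is the inverse Jacobian
  matrix of \<open>F\<close> evaluated at \<open>G\<close>, so if \<open>G\<close> is C^n then its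
  partials are C^n. The Jacobian is assumed nonzero on all of \<open>S\<close>, so that this formula
  holds on the whole ball.\<close>

lemma smooth_local_inverse:
  fixes F :: "real^2 \<Rightarrow> real^2"
  assumes S: "open S" "z0 \<in> S" and F: "\<And>i. smooth_on S (\<lambda>z. F z $ i)"
    and jac: "\<And>z. z \<in> S \<Longrightarrow> jacdet (\<lambda>z. F z $ 1) (\<lambda>z. F z $ 2) z \<noteq> 0"
  obtains V e G where "open V" "z0 \<in> V" "V \<subseteq> S" "e > 0" "homeomorphism V (ball (F z0) e) F G"
    "\<And>i. smooth_on (ball (F z0) e) (\<lambda>w. G w $ i)"
proof -
  define a where "a = pd 1 (\<lambda>z. F z $ 1)"
  define b where "b = pd 2 (\<lambda>z. F z $ 1)"
  define c where "c = pd 1 (\<lambda>z. F z $ 2)"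
  define d where "d = pd 2 (\<lambda>z. F z $ 2)"
  note abcd = a_def b_def c_def d_def
  have sm: "smooth_on S a" "smooth_on S b" "smooth_on S c" "smooth_on S d"
    unfolding abcd by (intro smooth_on_pd F)+
  have det: "a z * d z - b z * c z \<noteq> 0" if "z \<in> S" for z
    using jac[OF that] by (simp add: jacdet_def abcd)
  define k where "k = (\<lambda>z. inverse (a z * d z - b z * c z))"
  have k: "smooth_on S k"
    unfolding k_def by (intro smooth_on_intros S sm det)
  define F' where "F' = (\<lambda>z. mat_blinfun (a z) (b z) (c z) (d z))"
  define I where "I = (\<lambda>z. mat_blinfun (k z * d z) (- (k z * b z)) (- (k z * c z)) (k z * a z))"
  have inv: "I z o\<^sub>L F' z = id_blinfun" if "z \<in> S" for z
    unfolding I_def F'_def k_def by (rule mat_blinfun_adjugate[OF det[OF that]])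
  have derF: "(F has_derivative blinfun_apply (F' z)) (at z)" if "z \<in> S" for z
    using has_derivative_plane_map[OF S(1) F that] by (simp add: F'_def mat_blinfun_apply[abs_def] abcd)
  have "continuous_on S F'"
    unfolding F'_def mat_blinfun_def by (intro continuous_intros smooth_on_continuous_on[OF S(1)] sm)
  then obtain U V0 G where U: "open U" "U \<subseteq> S" "z0 \<in> U" "open V0" "homeomorphism U V0 F G"
    using inverse_function_theorem[OF S(1) derF _ S(2) inv[OF S(2)]] by metis
  obtain V e where V: "open V" "z0 \<in> V" "V \<subseteq> U" "e > 0" "homeomorphism V (ball (F z0) e) F G"
    using homeomorphism_restrict_ball[OF U(5,1,4,3)] by metis
  define B where "B = ball (F z0) e"
  have B: "open B" "homeomorphism V B F G" using V by (auto simp: B_def)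
  have GV: "G w \<in> V" "G w \<in> S" "F (G w) = w" if "w \<in> B" for w
    using that B(2) V(3) U(2) by (auto simp: homeomorphism_def)
  have contG: "continuous_on B G" using B(2) by (auto simp: homeomorphism_def)
  have derG: "(G has_derivative blinfun_apply (I (G w))) (at w)" if w: "w \<in> B" for w
  proof (rule has_derivative_inverse_basic[where g = G and y = w, OF derF[OF GV(2)[OF w]] _ _ _ B(1) w])
    show "bounded_linear (blinfun_apply (I (G w)))" by (rule blinfun.bounded_linear_right)
    show "blinfun_apply (I (G w)) \<circ> blinfun_apply (F' (G w)) = id"
    proof
      fix v
      from inv[OF GV(2)[OF w]] have "blinfun_apply (I (G w) o\<^sub>L F' (G w)) v = v" by simp
      then show "(blinfun_apply (I (G w)) \<circ> blinfun_apply (F' (G w))) v = id v" by simp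
    qed
    show "continuous (at w) G" using contG w B(1) by (simp add: continuous_on_eq_continuous_at)
  qed (use GV in auto)
  have dG: "has_differential (\<lambda>w. G w $ 1) (\<lambda>w. k (G w) * d (G w), \<lambda>w. - (k (G w) * b (G w))) B"
    "has_differential (\<lambda>w. G w $ 2) (\<lambda>w. - (k (G w) * c (G w)), \<lambda>w. k (G w) * a (G w)) B"
    unfolding has_differential_def
    using has_derivative_vec_nth[OF derG, of _ 1] has_derivative_vec_nth[OF derG, of _ 2]
    by (auto simp: I_def mat_blinfun_apply)
  have ckG: "ck n B (\<lambda>w. G w $ 1) \<and> ck n B (\<lambda>w. G w $ 2)" for n
  proof (induction n)
    case 0
    show ?case using contG by (auto intro!: continuous_intros)
  next
    case (Suc n)
    have comp: "ck n B (\<lambda>w. h (G w))" if "smooth_on S h" for h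
      using ck_compose[OF smooth_on_imp_ck[OF S(1) that]] Suc.IH GV(2) by blast
    have "ck n B (\<lambda>w. k (G w) * d (G w))" "ck n B (\<lambda>w. k (G w) * a (G w))"
      "ck n B (\<lambda>w. - (k (G w) * b (G w)))" "ck n B (\<lambda>w. - (k (G w) * c (G w)))"
      using comp[of "\<lambda>z. k z * d z"] comp[of "\<lambda>z. k z * a z"] comp[of "\<lambda>z. - (k z * b z)"]
        comp[of "\<lambda>z. - (k z * c z)"] by (simp_all add: smooth_on_mult smooth_on_minus k sm S(1))
    then show ?case using dG by (auto intro!: ck_SucI simp del: ck.simps)
  qed
  have "smooth_on B (\<lambda>w. G w $ i)" for i
    unfolding smooth_on_iff_ck[OF B(1)] using ckG exhaust_2[of i] by auto
  then show ?thesis using that[of V e G] V U(2) unfolding B_def by blast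
qed

section \<open>Convexity and the Hessian\<close>

text \<open>The mean value theorem on [0, t] and on [t, 1] turns the two chord slopes into values of
  \<open>h'\<close>, which is increasing.\<close>

lemma pos_second_derivative_strict_chord:
  fixes h :: "real \<Rightarrow> real"
  assumes h: "\<And>t. 0 \<le> t \<Longrightarrow> t \<le> 1 \<Longrightarrow> (h has_real_derivative h' t) (at t)"
    and h': "\<And>t. 0 \<le> t \<Longrightarrow> t \<le> 1 \<Longrightarrow> (h' has_real_derivative h'' t) (at t)"
    and pos: "\<And>t. 0 \<le> t \<Longrightarrow> t \<le> 1 \<Longrightarrow> h'' t > 0"
    and t: "0 < t" "t < 1"
  shows "h t < (1 - t) * h 0 + t * h 1"
proof -
  obtain s1 where s1: "0 < s1" "s1 < t" "h t - h 0 = (t - 0) * h' s1"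
    using MVT2[of 0 t h h'] h t by force
  obtain s2 where s2: "t < s2" "s2 < 1" "h 1 - h t = (1 - t) * h' s2"
    using MVT2[of t 1 h h'] h t by force
  have "h' s1 < h' s2"
  proof (rule DERIV_pos_imp_increasing[of s1 s2 h'])
    show "s1 < s2" using s1 s2 by simp
    fix x assume "s1 \<le> x" "x \<le> s2"
    then have "0 \<le> x" "x \<le> 1" using s1 s2 by auto
    then show "\<exists>y. (h' has_real_derivative y) (at x) \<and> 0 < y"
      using h' pos by blast
  qed
  then have "t * (1 - t) * h' s1 < t * (1 - t) * h' s2" using t by simp
  then have "(1 - t) * (h t - h 0) < t * (h 1 - h t)"
    unfolding s1(3) s2(3) by (simp add: mult.assoc mult.left_commute)
  then show ?thesis by (simp add: algebra_simps)
qed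

lemma line_derivative:
  fixes x v :: "real^2"
  assumes "open S" "smooth_on S g" "x + t *\<^sub>R v \<in> S"
  shows "((\<lambda>t. g (x + t *\<^sub>R v)) has_real_derivative
      pd 1 g (x + t *\<^sub>R v) * v $ 1 + pd 2 g (x + t *\<^sub>R v) * v $ 2) (at t)"
proof -
  have "((\<lambda>t. x + t *\<^sub>R v) has_derivative (\<lambda>t. t *\<^sub>R v)) (at t)"
    by (auto intro!: derivative_eq_intros)
  from has_derivative_compose[OF this smooth_on_has_derivative[OF assms]]
  show ?thesis
    unfolding has_field_derivative_def by (rule has_derivative_eq_rhs) (simp add: fun_eq_iff algebra_simps)
qed

text \<open>Positivity is asked in the single direction \<open>v\<close>. The lemma thus applies to
  \<open>u\<close> along any segment and also to \<open>-u\<close> along a horizontal one, where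
  just one second derivative has a known sign.\<close>

lemma line_strict_chord:
  fixes x v :: "real^2"
  assumes S: "open S" "smooth_on S g" and seg: "\<And>t. 0 \<le> t \<Longrightarrow> t \<le> 1 \<Longrightarrow> x + t *\<^sub>R v \<in> S"
    and pos: "\<And>w. w \<in> S \<Longrightarrow> 0 < pd 1 (pd 1 g) w * (v $ 1)\<^sup>2 + 2 * pd 1 (pd 2 g) w * v $ 1 * v $ 2
       + pd 2 (pd 2 g) w * (v $ 2)\<^sup>2"
    and t: "0 < t" "t < 1"
  shows "g (x + t *\<^sub>R v) < (1 - t) * g x + t * g (x + v)"
proof -
  define h' where "h' = (\<lambda>w. pd 1 g w * v $ 1 + pd 2 g w * v $ 2)"
  have sm: "smooth_on S (pd i g)" for i by (rule smooth_on_pd[OF S(2)])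
  have h': "smooth_on S h'"
    unfolding h'_def by (intro smooth_on_intros S sm)
  have pdh': "pd i h' w = pd i (pd 1 g) w * v $ 1 + pd i (pd 2 g) w * v $ 2" if "w \<in> S" for i w
    unfolding h'_def
    using pd_add[OF S(1) smooth_on_mult[OF S(1) sm smooth_on_const[OF S(1)]]
        smooth_on_mult[OF S(1) sm smooth_on_const[OF S(1)]] that]
      pd_mult[OF S(1) sm smooth_on_const[OF S(1)] that] by simp
  have "g (x + t *\<^sub>R v) < (1 - t) * g (x + 0 *\<^sub>R v) + t * g (x + 1 *\<^sub>R v)"
  proof (rule pos_second_derivative_strict_chord[OF _ _ _ t])
    fix t :: real assume t: "0 \<le> t" "t \<le> 1"
    show "((\<lambda>t. g (x + t *\<^sub>R v)) has_real_derivative h' (x + t *\<^sub>R v)) (at t)"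
      unfolding h'_def by (rule line_derivative[OF S seg[OF t]])
    show "((\<lambda>t. h' (x + t *\<^sub>R v)) has_real_derivative
        pd 1 h' (x + t *\<^sub>R v) * v $ 1 + pd 2 h' (x + t *\<^sub>R v) * v $ 2) (at t)"
      by (rule line_derivative[OF S(1) h' seg[OF t]])
    show "0 < pd 1 h' (x + t *\<^sub>R v) * v $ 1 + pd 2 h' (x + t *\<^sub>R v) * v $ 2"
      using pos[OF seg[OF t]] pd_commute[OF S seg[OF t]]
      by (simp add: pdh'[OF seg[OF t]] algebra_simps power2_eq_square)
  qed
  then show ?thesis by simp
qed

lemma hessdet_2:
  fixes z :: "real^2"
  shows "hessdet u z = pd 1 (pd 1 u) z * pd 2 (pd 2 u) z - pd 1 (pd 2 u) z * pd 2 (pd 1 u) z"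
  by (simp add: hessdet_def hess_def det_2)

lemma quadratic_form_pos:
  fixes a b c x y :: real
  assumes "a > 0" "a * c - b * b > 0" "x \<noteq> 0 \<or> y \<noteq> 0"
  shows "0 < a * x\<^sup>2 + 2 * b * x * y + c * y\<^sup>2"
proof -
  have "a * (a * x\<^sup>2 + 2 * b * x * y + c * y\<^sup>2) = (a * x + b * y)\<^sup>2 + (a * c - b * b) * y\<^sup>2"
    by (simp add: algebra_simps power2_eq_square)
  also have "\<dots> > 0"
  proof (cases "y = 0")
    case True
    then show ?thesis using assms by simp
  next
    case False
    then show ?thesis using assms by (intro add_nonneg_pos mult_pos_pos) auto
  qed
  finally show ?thesis using assms(1) by (simp add: zero_less_mult_iff)
qed

lemma strictly_convex_onI:
  fixes u :: "real^2 \<Rightarrow> real"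
  assumes W: "open W" "convex W" and u: "smooth_on W u"
    and pos: "\<And>w. w \<in> W \<Longrightarrow> pd 1 (pd 1 u) w > 0" "\<And>w. w \<in> W \<Longrightarrow> hessdet u w > 0"
  shows "strictly_convex_on W u"
proof -
  have strict: "u ((1 - t) *\<^sub>R x + t *\<^sub>R y) < (1 - t) * u x + t * u y"
    if xy: "x \<in> W" "y \<in> W" "x \<noteq> y" and t: "0 < t" "t < 1" for x y :: "real^2" and t :: real
  proof -
    define v where "v = y - x"
    have v: "v $ 1 \<noteq> 0 \<or> v $ 2 \<noteq> 0" using xy(3) by (auto simp: v_def vec_eq_iff forall_2)
    have line: "(1 - s) *\<^sub>R x + s *\<^sub>R y = x + s *\<^sub>R v" for s
      by (simp add: v_def algebra_simps)
    have "u (x + t *\<^sub>R v) < (1 - t) * u x + t * u (x + v)"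
    proof (rule line_strict_chord[OF W(1) u _ _ t])
      fix s :: real assume "0 \<le> s" "s \<le> 1"
      then show "x + s *\<^sub>R v \<in> W"
        unfolding line[symmetric] using convexD[OF W(2) xy(1,2), of "1 - s" s] by simp
    next
      fix w assume w: "w \<in> W"
      show "0 < pd 1 (pd 1 u) w * (v $ 1)\<^sup>2 + 2 * pd 1 (pd 2 u) w * v $ 1 * v $ 2
       + pd 2 (pd 2 u) w * (v $ 2)\<^sup>2"
        using pos[OF w] pd_commute[OF W(1) u w] v by (intro quadratic_form_pos) (auto simp: hessdet_2)
    qed
    then show ?thesis unfolding line by (simp add: v_def)
  qed
  have "convex_on W u"
  proof (rule convex_onI[OF _ W(2)])
    fix t :: real and x y assume t: "0 < t" "t < 1" and xy: "x \<in> W" "y \<in> W"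
    show "u ((1 - t) *\<^sub>R x + t *\<^sub>R y) \<le> (1 - t) * u x + t * u y"
    proof (cases "x = y")
      case True
      then show ?thesis by (simp add: algebra_simps scaleR_add_left[symmetric])
    next
      case False
      then show ?thesis using strict[OF xy _ t] by simp
    qed
  qed
  then show ?thesis using strict by (simp add: strictly_convex_on_def)
qed

text \<open>If \<open>u_11\<close> were zero, the determinant would be minus a square. If it were
  negative, \<open>-u\<close> would have positive second derivative along a short horizontal
  segment, and its strict chord inequality would contradict convexity of \<open>u\<close> at the
  midpoint.\<close>

lemma convex_on_imp_pd_pos:
  fixes u :: "real^2 \<Rightarrow> real"
  assumes S: "open S" "smooth_on S u" and conv: "convex_on S u" and z: "z \<in> S" "hessdet u z > 0"
  shows "pd 1 (pd 1 u) z > 0"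
proof (rule ccontr)
  assume "\<not> ?thesis"
  moreover have "pd 1 (pd 1 u) z \<noteq> 0"
    using z(2) pd_commute[OF S z(1)] by (auto simp: hessdet_2 mult_less_0_iff not_less)
  ultimately have neg: "pd 1 (pd 1 u) z < 0" by simp
  have "continuous_on S (pd 1 (pd 1 u))"
    by (intro smooth_on_continuous_on smooth_on_pd S)
  then have "open (S \<inter> pd 1 (pd 1 u) -` {..<0})"
    using S by (intro continuous_open_preimage) auto
  moreover have "z \<in> S \<inter> pd 1 (pd 1 u) -` {..<0}" using neg z by simp
  ultimately obtain e where e: "e > 0" "ball z e \<subseteq> S \<inter> pd 1 (pd 1 u) -` {..<0}"
    using openE by blast
  define v where "v = e *\<^sub>R axis (1::2) (1::real)"
  \<comment> \<open>\<open>z\<close> is the midpoint of a segment of length e, which therefore stays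
    inside the ball.\<close>
  define x where "x = z - (1/2) *\<^sub>R v"
  have v: "v $ 1 = e" "v $ 2 = 0" by (simp_all add: v_def axis_pt)
  have seg: "x + t *\<^sub>R v \<in> ball z e" if "0 \<le> t" "t \<le> 1" for t
  proof -
    have "z - (x + t *\<^sub>R v) = ((1/2 - t) * e) *\<^sub>R axis 1 1"
      by (simp add: x_def v_def algebra_simps)
    then have "dist z (x + t *\<^sub>R v) = \<bar>1/2 - t\<bar> * e"
      using e(1) by (simp add: dist_norm norm_axis_1 abs_mult)
    also have "\<dots> < 1 * e" using that e(1) by (intro mult_strict_right_mono) auto
    finally show ?thesis by simp
  qed
  have sub: "ball z e \<subseteq> S" using e by auto
  have sm: "smooth_on (ball z e) u" by (rule smooth_on_subset[OF S(2) sub])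
  have pdm: "pd 1 (pd 1 (\<lambda>w. - u w)) w = - pd 1 (pd 1 u) w" if "w \<in> ball z e" for w
  proof -
    have "pd 1 (pd 1 (\<lambda>w. - u w)) w = pd 1 (\<lambda>w. - pd 1 u w) w"
      by (rule pd_cong[OF open_ball that]) (rule pd_minus[OF open_ball sm])
    then show ?thesis using pd_minus[OF open_ball smooth_on_pd[OF sm] that] by simp
  qed
  have "- u (x + (1/2) *\<^sub>R v) < (1 - 1/2) * - u x + 1/2 * - u (x + v)"
  proof (rule line_strict_chord[OF open_ball smooth_on_minus[OF open_ball sm] seg])
    fix w assume w: "w \<in> ball z e"
    have "- pd 1 (pd 1 u) w * e\<^sup>2 > 0" using w e by (intro mult_pos_pos) auto
    then show "0 < pd 1 (pd 1 (\<lambda>w. - u w)) w * (v $ 1)\<^sup>2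
        + 2 * pd 1 (pd 2 (\<lambda>w. - u w)) w * v $ 1 * v $ 2 + pd 2 (pd 2 (\<lambda>w. - u w)) w * (v $ 2)\<^sup>2"
      by (simp add: v pdm[OF w])
  qed auto
  moreover have "u ((1 - 1/2) *\<^sub>R x + (1/2) *\<^sub>R (x + v)) \<le> (1 - 1/2) * u x + 1/2 * u (x + v)"
    using seg[of 0] seg[of 1] sub by (intro convex_onD[OF conv]) auto
  moreover have "(1 - 1/2) *\<^sub>R x + (1/2) *\<^sub>R (x + v) = x + (1/2) *\<^sub>R v"
    by (simp add: algebra_simps scaleR_add_left[symmetric])
  ultimately show False by simp
qed

section \<open>Divergence form of equation (2)\<close>

lemma matrix_inv_eqI:
  fixes A B :: "'a::comm_ring_1^'n^'n"
  assumes "A ** B = mat 1" "B ** A = mat 1"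
  shows "matrix_inv A = B"
  unfolding matrix_inv_def
proof (rule some_equality)
  fix C assume C: "A ** C = mat 1 \<and> C ** A = mat 1"
  have "C = C ** (A ** B)" using assms by simp
  also have "\<dots> = (C ** A) ** B" by (simp add: matrix_mul_assoc)
  also have "\<dots> = B" using C by simp
  finally show "C = B" .
qed (use assms in blast)

text \<open>Stated with the factor \<open>det A\<close>, because (2) contains the inverse Hessian
  through the cofactors \<open>J u^{ij}\<close>.\<close>

lemma matrix_inv_2:
  fixes A :: "real^2^2"
  assumes "det A \<noteq> 0"
  shows "det A * matrix_inv A $ 1 $ 1 = A $ 2 $ 2" "det A * matrix_inv A $ 1 $ 2 = - A $ 1 $ 2"
    "det A * matrix_inv A $ 2 $ 1 = - A $ 2 $ 1" "det A * matrix_inv A $ 2 $ 2 = A $ 1 $ 1"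
proof -
  define B :: "real^2^2" where "B = (\<chi> i j. (if i = 1 then (if j = 1 then A $ 2 $ 2 else - A $ 1 $ 2)
      else (if j = 1 then - A $ 2 $ 1 else A $ 1 $ 1)) * inverse (det A))"
  have "(A $ 1 $ 1 * A $ 2 $ 2 - A $ 1 $ 2 * A $ 2 $ 1) * inverse (det A) = 1"
    using assms by (simp add: det_2)
  then have "matrix_inv A = B"
    by (intro matrix_inv_eqI)
      (auto simp: vec_eq_iff forall_2 matrix_matrix_mult_def sum_2 mat_def B_def algebra_simps)
  then show "det A * matrix_inv A $ 1 $ 1 = A $ 2 $ 2" "det A * matrix_inv A $ 1 $ 2 = - A $ 1 $ 2"
    "det A * matrix_inv A $ 2 $ 1 = - A $ 2 $ 1" "det A * matrix_inv A $ 2 $ 2 = A $ 1 $ 1"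
    using assms by (simp_all add: B_def)
qed

text \<open>The stream function \<open>H\<close> of the field (flux1, flux2) satisfies \<open>dH = flux2 dx\<^sub>1 - flux1 dx\<^sub>2\<close>.\<close>

definition flux1 :: "(real \<Rightarrow> real) \<Rightarrow> (real^2 \<Rightarrow> real) \<Rightarrow> real^2 \<Rightarrow> real" where
  "flux1 \<psi> u z = pd 1 (\<lambda>w. deriv \<psi> (hessdet u w)) z * pd 2 (pd 2 u) z
     - pd 2 (\<lambda>w. deriv \<psi> (hessdet u w)) z * pd 1 (pd 2 u) z"

definition flux2 :: "(real \<Rightarrow> real) \<Rightarrow> (real^2 \<Rightarrow> real) \<Rightarrow> real^2 \<Rightarrow> real" where
  "flux2 \<psi> u z = pd 2 (\<lambda>w. deriv \<psi> (hessdet u w)) z * pd 1 (pd 1 u) z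
     - pd 1 (\<lambda>w. deriv \<psi> (hessdet u w)) z * pd 1 (pd 2 u) z"

lemma smooth_on_hessdet:
  fixes u :: "real^2 \<Rightarrow> real"
  assumes "open S" "smooth_on S u"
  shows "smooth_on S (hessdet u)"
  unfolding hessdet_2[abs_def] by (intro smooth_on_intros assms)

lemma smooth_on_deriv_hessdet:
  fixes u :: "real^2 \<Rightarrow> real"
  assumes "smooth1_on {0<..} \<psi>" "open S" "smooth_on S u" "\<And>z. z \<in> S \<Longrightarrow> hessdet u z > 0"
  shows "smooth_on S (\<lambda>w. deriv \<psi> (hessdet u w))"
  using smooth_on_smooth1_compose[OF assms(2) smooth_on_hessdet[OF assms(2,3)] smooth1_on_deriv[OF assms(1)]]
    assms(4) by simp

lemma smooth_on_flux:
  fixes u :: "real^2 \<Rightarrow> real"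
  assumes "smooth1_on {0<..} \<psi>" "open S" "smooth_on S u" "\<And>z. z \<in> S \<Longrightarrow> hessdet u z > 0"
  shows "smooth_on S (flux1 \<psi> u)" "smooth_on S (flux2 \<psi> u)"
  unfolding flux1_def[abs_def] flux2_def[abs_def]
  by (intro smooth_on_intros smooth_on_deriv_hessdet assms; simp)+

text \<open>The gain is a drop in order. In each row sum the inner derivative hits both
  \<open>g\<close> and the cofactor; the third derivatives of \<open>u\<close> cancel by symmetry,
  and just the first derivatives of \<open>g\<close> survive.\<close>

lemma eq2_iff_flux:
  fixes u :: "real^2 \<Rightarrow> real"
  assumes psi: "smooth1_on {0<..} \<psi>" and S: "open S" and u: "smooth_on S u"
    and pos: "\<And>z. z \<in> S \<Longrightarrow> hessdet u z > 0"
  shows "eq2 \<psi> S u \<longleftrightarrow> (\<forall>z\<in>S. pd 1 (flux1 \<psi> u) z + pd 2 (flux2 \<psi> u) z = 0)"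
proof -
  define g where "g = (\<lambda>w. deriv \<psi> (hessdet u w))"
  have g: "smooth_on S g"
    unfolding g_def by (rule smooth_on_deriv_hessdet[OF psi S u pos])
  have uu: "smooth_on S (pd i (pd j u))" for i j
    by (intro smooth_on_pd u)
  define F where "F = (\<lambda>i j w. hessdet u w * deriv \<psi> (hessdet u w) * matrix_inv (hess u w) $ i $ j)"
  have F: "F 1 1 w = g w * pd 2 (pd 2 u) w" "F 1 2 w = - (g w * pd 1 (pd 2 u) w)"
    "F 2 1 w = - (g w * pd 2 (pd 1 u) w)" "F 2 2 w = g w * pd 1 (pd 1 u) w" if w: "w \<in> S" for w
  proof -
    have "det (hess u w) \<noteq> 0" using pos[OF w] by (simp add: hessdet_def)
    note inv = matrix_inv_2[OF this]
    have "F i j w = g w * (det (hess u w) * matrix_inv (hess u w) $ i $ j)" for i j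
      by (simp add: F_def g_def hessdet_def)
    then show "F 1 1 w = g w * pd 2 (pd 2 u) w" "F 1 2 w = - (g w * pd 1 (pd 2 u) w)"
      "F 2 1 w = - (g w * pd 2 (pd 1 u) w)" "F 2 2 w = g w * pd 1 (pd 1 u) w"
      unfolding inv by (simp_all only: inv) (simp_all add: hess_def)
  qed
  \<comment> \<open>\<open>matrix_inv\<close> is defined by choice, so smoothness is transferred
    from the cofactor formulas.\<close>
  have smF: "smooth_on S (F 1 1)" "smooth_on S (F 1 2)" "smooth_on S (F 2 1)" "smooth_on S (F 2 2)"
    using smooth_on_cong[OF S smooth_on_mult[OF S g uu] F(1)[symmetric]]
      smooth_on_cong[OF S smooth_on_minus[OF S smooth_on_mult[OF S g uu]] F(2)[symmetric]]
      smooth_on_cong[OF S smooth_on_minus[OF S smooth_on_mult[OF S g uu]] F(3)[symmetric]]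
      smooth_on_cong[OF S smooth_on_mult[OF S g uu] F(4)[symmetric]]
    by blast+
  have pdF: "pd k (F 1 1) w = pd k g w * pd 2 (pd 2 u) w + g w * pd k (pd 2 (pd 2 u)) w"
    "pd k (F 1 2) w = - (pd k g w * pd 1 (pd 2 u) w + g w * pd k (pd 1 (pd 2 u)) w)"
    "pd k (F 2 1) w = - (pd k g w * pd 2 (pd 1 u) w + g w * pd k (pd 2 (pd 1 u)) w)"
    "pd k (F 2 2) w = pd k g w * pd 1 (pd 1 u) w + g w * pd k (pd 1 (pd 1 u)) w" if w: "w \<in> S" for k w
    using pd_cong[OF S w F(1)] pd_cong[OF S w F(2)] pd_cong[OF S w F(3)] pd_cong[OF S w F(4)]
      pd_mult[OF S g uu w] pd_minus[OF S smooth_on_mult[OF S g uu] w]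
    by simp_all
  have row1: "pd 1 (F 1 1) w + pd 2 (F 1 2) w = flux1 \<psi> u w" if w: "w \<in> S" for w
    using pd_commute[OF S smooth_on_pd[OF u, of 2] w]
    by (simp add: pdF[OF w] flux1_def g_def)
  have row2: "pd 1 (F 2 1) w + pd 2 (F 2 2) w = flux2 \<psi> u w" if w: "w \<in> S" for w
    using pd_commute[OF S smooth_on_pd[OF u, of 1] w] pd_commute[OF S u w]
    by (simp add: pdF[OF w] flux2_def g_def)
  have "(\<Sum>i\<in>UNIV. \<Sum>j\<in>UNIV. pd i (pd j (F i j)) z) = pd 1 (flux1 \<psi> u) z + pd 2 (flux2 \<psi> u) z"
    if z: "z \<in> S" for z
  proof -
    have "pd 1 (flux1 \<psi> u) z = pd 1 (\<lambda>w. pd 1 (F 1 1) w + pd 2 (F 1 2) w) z"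
      by (rule pd_cong[OF S z]) (simp add: row1)
    also have "\<dots> = pd 1 (pd 1 (F 1 1)) z + pd 1 (pd 2 (F 1 2)) z"
      by (rule pd_add[OF S _ _ z]) (intro smooth_on_pd smF)+
    finally have 1: "pd 1 (flux1 \<psi> u) z = \<dots>" .
    have "pd 2 (flux2 \<psi> u) z = pd 2 (\<lambda>w. pd 1 (F 2 1) w + pd 2 (F 2 2) w) z"
      by (rule pd_cong[OF S z]) (simp add: row2)
    also have "\<dots> = pd 2 (pd 1 (F 2 1)) z + pd 2 (pd 2 (F 2 2)) z"
      by (rule pd_add[OF S _ _ z]) (intro smooth_on_pd smF)+
    finally show ?thesis using 1 by (simp add: sum_2)
  qed
  then show ?thesis unfolding eq2_def F_def by simp
qed

lemma has_differentialI_pd: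
  assumes "open S" "smooth_on S g" "\<And>z. z \<in> S \<Longrightarrow> pd 1 g z = a z" "\<And>z. z \<in> S \<Longrightarrow> pd 2 g z = b z"
  shows "has_differential g (a, b) S"
  by (rule has_differential_cong[OF assms(1) smooth_on_differential[OF assms(1,2)]]) (simp_all add: assms)

text \<open>The chain rule for \<open>F \<circ> G = id\<close>, entry by entry. The two planes
  exchange roles between (a), where \<open>F\<close> starts in the (H, r)-plane, and (b), where it
  starts in the (x1, x2)-plane.\<close>

lemma inverse_pair_jacobian:
  fixes F G :: "real^2 \<Rightarrow> real^2"
  assumes "open S" "open T" "\<And>i. smooth_on S (\<lambda>z. F z $ i)" "\<And>i. smooth_on T (\<lambda>w. G w $ i)"
    and "\<And>w. w \<in> T \<Longrightarrow> G w \<in> S \<and> F (G w) = w" and w: "w \<in> T"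
  shows "pd 1 (\<lambda>z. F z $ j) (G w) * pd i (\<lambda>w. G w $ 1) w + pd 2 (\<lambda>z. F z $ j) (G w) * pd i (\<lambda>w. G w $ 2) w
    = (if i = j then 1 else 0)"
proof -
  have "pd i (\<lambda>w. F (G w) $ j) w = pd i (\<lambda>w. w $ j) w"
    by (rule pd_cong[OF assms(2) w]) (simp add: assms(5))
  moreover have "G w \<in> S" using assms(5) w by blast
  ultimately show ?thesis
    using pd_compose[OF assms(2,4) w smooth_on_has_derivative[OF assms(1,3)], of i j] by (simp add: pd_nth)
qed

section \<open>The functions f and p\<close>

locale density =
  fixes \<psi> f :: "real \<Rightarrow> real"
  assumes psi_smooth: "smooth1_on {0<..} \<psi>"
    and psi_pos: "\<And>t. t > 0 \<Longrightarrow> deriv (deriv \<psi>) t > 0"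
    and f_deriv: "\<And>t. t > 0 \<Longrightarrow> (f has_real_derivative (sqrt t * deriv (deriv \<psi>) t)) (at t)"
begin

abbreviation "finv \<equiv> inv_into {0<..} f"

lemma f_deriv_pos: "t > 0 \<Longrightarrow> sqrt t * deriv (deriv \<psi>) t > 0"
  using psi_pos by simp

lemma f_less: "0 < s \<Longrightarrow> s < t \<Longrightarrow> f s < f t"
  by (rule DERIV_pos_imp_increasing[of s t f]) (auto intro!: exI f_deriv f_deriv_pos)

lemma f_inj: "inj_on f {0<..}"
  by (rule linorder_inj_onI) (use f_less in fastforce)+

lemma f_continuous: "continuous_on {0<..} f"
  using f_deriv by (meson DERIV_isCont continuous_at_imp_continuous_on greaterThan_iff)

lemma finv_f [simp]: "t > 0 \<Longrightarrow> finv (f t) = t"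
  using f_inj by simp

lemma f_finv: "r \<in> f ` {0<..} \<Longrightarrow> f (finv r) = r"
  by (rule f_inv_into_f)

lemma finv_pos: "r \<in> f ` {0<..} \<Longrightarrow> finv r > 0"
  using inv_into_into[of r f "{0<..}"] by simp

text \<open>Trades the real power for an inverse square root, the form covered by
  \<open>ck_inverse\<close> and \<open>ck_sqrt\<close>.\<close>

lemma pfun_eq: "r \<in> f ` {0<..} \<Longrightarrow> pfun f r = inverse (sqrt (finv r))"
  using finv_pos[of r] powr_minus[of "finv r" "1/2"] by (simp add: pfun_def powr_half_sqrt)

lemma pfun_pos: "r \<in> f ` {0<..} \<Longrightarrow> pfun f r > 0"
  using finv_pos by (simp add: pfun_eq)

lemma pfun_square: "r \<in> f ` {0<..} \<Longrightarrow> pfun f r * pfun f r = inverse (finv r)"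
  using finv_pos[of r] by (simp add: pfun_eq flip: inverse_mult_distrib)

lemma finv_deriv:
  assumes "r \<in> f ` {0<..}"
  shows "(finv has_real_derivative inverse (sqrt (finv r) * deriv (deriv \<psi>) (finv r))) (at r)"
proof -
  let ?d = "sqrt (finv r) * deriv (deriv \<psi>) (finv r)"
  have "?d \<noteq> 0" using f_deriv_pos[OF finv_pos[OF assms]] by (rule less_imp_neq[symmetric])
  then have "(*) ?d \<circ> (*) (inverse ?d) = id" by (simp add: fun_eq_iff field_simps)
  from has_derivative_inverse_strong[OF open_greaterThan _ f_continuous _
      f_deriv[unfolded has_field_derivative_def] this]
  show ?thesis
    using finv_pos[OF assms] by (simp add: has_field_derivative_def f_finv assms)
qed

text \<open>Bootstrapping through \<open>finv' = 1 / (sqrt finv * psi''(finv))\<close>, whose right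
  side is an expression in \<open>finv\<close>. The one-variable function is read as a planar one,
  the setting of \<open>ck\<close>.\<close>

lemma smooth_on_finv:
  fixes S :: "(real^2) set"
  assumes S: "open S" and r: "\<And>z. z \<in> S \<Longrightarrow> z $ 2 \<in> f ` {0<..}"
  shows "smooth_on S (\<lambda>z. finv (z $ 2))"
  unfolding smooth_on_iff_ck[OF S]
proof
  fix k
  have d: "has_differential (\<lambda>z. finv (z $ 2))
    (\<lambda>z. inverse (sqrt (finv (z $ 2)) * deriv (deriv \<psi>) (finv (z $ 2))) * pd 1 (\<lambda>z. z $ 2) z,
     \<lambda>z. inverse (sqrt (finv (z $ 2)) * deriv (deriv \<psi>) (finv (z $ 2))) * pd 2 (\<lambda>z. z $ 2) z) S"
    by (rule has_differential_compose_real[OF smooth_on_differential[OF S smooth_on_nth[OF S]] finv_deriv[OF r]])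
  have ck_psi: "ck n S (\<lambda>z. deriv (deriv \<psi>) (finv (z $ 2)))" if ck: "ck n S (\<lambda>z. finv (z $ 2))" for n
  proof -
    \<comment> \<open>During the induction \<open>finv\<close> is known to be C^n at most, while the
      one-variable composition lemma asks for a smooth inner function. So \<open>psi''\<close>
      becomes a smooth function on a half-plane and is composed by
      \<open>ck_compose\<close>.\<close>
    define T where "T = {z :: real^2. z $ 2 > 0}"
    have T: "open T" unfolding T_def by (intro open_Collect_less continuous_intros)
    have "smooth_on T (\<lambda>z. deriv (deriv \<psi>) (z $ 2))"
      using smooth_on_smooth1_compose[OF T smooth_on_nth[OF T] smooth1_on_deriv[OF smooth1_on_deriv[OF psi_smooth]]]
      by (simp add: T_def)
    from ck_compose[OF smooth_on_imp_ck[OF T this], of n S "\<lambda>z. pt 0 (finv (z $ 2))"]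
    show ?thesis using ck by (simp add: ck_const T_def finv_pos r)
  qed
  show "ck k S (\<lambda>z. finv (z $ 2))"
  proof (induction k)
    case 0
    show ?case using has_differential_continuous_on[OF d] by simp
  next
    case (Suc k)
    have "ck k S (\<lambda>z. inverse (sqrt (finv (z $ 2)) * deriv (deriv \<psi>) (finv (z $ 2))))"
      by (intro ck_inverse ck_mult ck_sqrt Suc.IH ck_psi finv_pos r
          less_imp_neq[OF f_deriv_pos[OF finv_pos[OF r]], symmetric])
    then show ?case
      by (intro ck_SucI[OF d] ck_mult) (auto intro!: ck_const simp: pd_nth)
  qed
qed

lemma smooth_on_pfun:
  fixes S :: "(real^2) set"
  assumes S: "open S" and r: "\<And>z. z \<in> S \<Longrightarrow> z $ 2 \<in> f ` {0<..}"
  shows "smooth_on S (\<lambda>z. pfun f (z $ 2))"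
proof -
  have "sqrt (finv (z $ 2)) \<noteq> 0" if "z \<in> S" for z using finv_pos[OF r[OF that]] by simp
  then have "smooth_on S (\<lambda>z. inverse (sqrt (finv (z $ 2))))"
    by (intro smooth_on_inverse smooth_on_sqrt smooth_on_finv S r finv_pos)
  then show ?thesis by (rule smooth_on_cong[OF S]) (simp add: pfun_eq r)
qed

lemma pd_pfun [simp]: "pd 1 (\<lambda>z :: real^2. pfun f (z $ 2)) z = 0"
  by (simp add: pd_def axis_pt)

lemma smooth_on_f_compose:
  fixes g :: "real^2 \<Rightarrow> real"
  assumes S: "open S" "smooth_on S g" and pos: "\<And>z. z \<in> S \<Longrightarrow> g z > 0"
  shows "smooth_on S (\<lambda>z. f (g z))"
    and "z \<in> S \<Longrightarrow> pd i (\<lambda>z. f (g z)) z = sqrt (g z) * deriv (deriv \<psi>) (g z) * pd i g z"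
proof -
  note d = has_differential_compose_real[OF smooth_on_differential[OF S] f_deriv[OF pos]]
  have "smooth_on S (\<lambda>z. deriv (deriv \<psi>) (g z))"
    using smooth_on_smooth1_compose[OF S smooth1_on_deriv[OF smooth1_on_deriv[OF psi_smooth]]] pos by simp
  then show "smooth_on S (\<lambda>z. f (g z))"
    by (intro smooth_onI_differential[OF S(1) d] smooth_on_intros S pos)
  show "z \<in> S \<Longrightarrow> pd i (\<lambda>z. f (g z)) z = sqrt (g z) * deriv (deriv \<psi>) (g z) * pd i g z"
    using has_differential_pd[OF d] exhaust_2[of i] by auto
qed

text \<open>Here the equation for \<open>f\<close> enters: \<open>f' = sqrt t * psi''\<close> makes
  the differential of \<open>psi'(J)\<close> equal to \<open>J^(-1/2)\<close> times that of
  \<open>f(J)\<close>, and \<open>J^(-1/2)\<close> is p at r.\<close>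

lemma pd_deriv_psi_compose:
  fixes g :: "real^2 \<Rightarrow> real"
  assumes S: "open S" "smooth_on S g" and pos: "\<And>z. z \<in> S \<Longrightarrow> g z > 0" and z: "z \<in> S"
  shows "pd i (\<lambda>z. deriv \<psi> (g z)) z = pfun f (f (g z)) * pd i (\<lambda>z. f (g z)) z"
proof -
  have "(deriv \<psi> has_real_derivative deriv (deriv \<psi>) (g z)) (at (g z))" if "z \<in> S" for z
    using smooth1_on_DERIV[OF smooth1_on_deriv[OF psi_smooth]] pos[OF that] by simp
  from has_differential_pd[OF has_differential_compose_real[OF smooth_on_differential[OF S] this] z]
  have "pd i (\<lambda>z. deriv \<psi> (g z)) z = deriv (deriv \<psi>) (g z) * pd i g z"
    using exhaust_2[of i] by auto
  moreover have "sqrt (g z) > 0" using pos[OF z] by simp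
  ultimately show ?thesis
    using pos[OF z] by (simp add: smooth_on_f_compose(2)[OF S pos z] pfun_eq field_simps)
qed

end

section \<open>From equation (3) to equation (2)\<close>

lemma linear_system_zero:
  fixes a b c d x y :: real
  assumes "x * a + y * b = 0" "x * c + y * d = 0" "a * d - b * c \<noteq> 0"
  shows "x = 0" "y = 0"
proof -
  have "x * (a * d - b * c) = d * (x * a + y * b) - b * (x * c + y * d)"
    "y * (a * d - b * c) = a * (x * c + y * d) - c * (x * a + y * b)"
    by (simp_all add: algebra_simps)
  then show "x = 0" "y = 0" unfolding assms(1,2) using assms(3) by simp_all
qed

text \<open>With a, b and c, d the (H, r)-partials of xi1 and xi2, the map from (H, r) to (x1, x2)
  has Jacobian matrix \<open>P [[d, -c], [-b, a]]\<close>, whose inverse is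
  \<open>k [[a, c], [b, d]]\<close>. So the gradients of H and r are proportional to the columns of
  the Jacobian matrix of xi.\<close>

lemma conjugate_jacobian_inverse:
  fixes a b c d P H1 H2 r1 r2 :: real
  assumes "P * d * H1 - P * c * r1 = 1" "P * d * H2 - P * c * r2 = 0"
    "P * a * r1 - P * b * H1 = 0" "P * a * r2 - P * b * H2 = 1"
    and D: "a * d - b * c > 0" and P: "P > 0"
  obtains k where "k > 0" "P * k * (a * d - b * c) = 1" "H1 = k * a" "H2 = k * c" "r1 = k * b" "r2 = k * d"
proof -
  define k where "k = inverse (P * (a * d - b * c))"
  have "P * (a * d - b * c) > 0" using D P by simp
  then have "k > 0" "k * (P * (a * d - b * c)) = 1"
    unfolding k_def by (rule positive_imp_inverse_positive, intro left_inverse) auto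
  then have k: "k > 0" "P * k * (a * d - b * c) = 1" by (simp_all only: mult_ac)
  have e: "P * k * (a * d - b * c) * H1 = k * (a * (P * d * H1 - P * c * r1) + c * (P * a * r1 - P * b * H1))"
    "P * k * (a * d - b * c) * H2 = k * (a * (P * d * H2 - P * c * r2) + c * (P * a * r2 - P * b * H2))"
    "P * k * (a * d - b * c) * r1 = k * (b * (P * d * H1 - P * c * r1) + d * (P * a * r1 - P * b * H1))"
    "P * k * (a * d - b * c) * r2 = k * (b * (P * d * H2 - P * c * r2) + d * (P * a * r2 - P * b * H2))"
    by (simp_all add: algebra_simps)
  note e = e[unfolded k(2) assms(1-4)]
  show ?thesis by (rule that[OF k]) (use e in simp_all)
qed

text \<open>\<open>X\<close> maps the \<open>(H, r)\<close>-plane to the \<open>(x\<^sub>1, x\<^sub>2)\<close>-plane.\<close>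

locale hodograph = density \<psi> f for \<psi> f +
  fixes V W :: "(real^2) set" and X Y :: "real^2 \<Rightarrow> real^2" and \<xi>1 \<xi>2 U :: "real^2 \<Rightarrow> real"
  assumes open_V: "open V" and open_W: "open W" and homeo: "homeomorphism V W X Y"
    and X_smooth: "\<And>i. smooth_on V (\<lambda>z. X z $ i)" and Y_smooth: "\<And>i. smooth_on W (\<lambda>w. Y w $ i)"
    and r_range: "\<And>z. z \<in> V \<Longrightarrow> z $ 2 \<in> f ` {0<..}"
    and xi_smooth: "smooth_on V \<xi>1" "smooth_on V \<xi>2"
    and jac_pos: "\<And>z. z \<in> V \<Longrightarrow> jacdet \<xi>1 \<xi>2 z > 0"
    and dX1: "has_differential (\<lambda>z. X z $ 1) (eps1 (pfun f) \<xi>1 \<xi>2) V"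
    and dX2: "has_differential (\<lambda>z. X z $ 2) (eps2 (pfun f) \<xi>1 \<xi>2) V"
    and U_smooth: "smooth_on W U"
    and dU: "has_differential (\<lambda>z. U (X z)) (eps (pfun f) \<xi>1 \<xi>2) V"
begin

lemma Y_mem: "w \<in> W \<Longrightarrow> Y w \<in> V" and X_Y: "w \<in> W \<Longrightarrow> X (Y w) = w"
  using homeo by (auto simp: homeomorphism_def)

lemma pd_X:
  assumes "z \<in> V"
  shows "pd 1 (\<lambda>z. X z $ 1) z = pfun f (z $ 2) * pd 2 \<xi>2 z" "pd 2 (\<lambda>z. X z $ 1) z = - (pfun f (z $ 2) * pd 1 \<xi>2 z)"
    "pd 1 (\<lambda>z. X z $ 2) z = - (pfun f (z $ 2) * pd 2 \<xi>1 z)" "pd 2 (\<lambda>z. X z $ 2) z = pfun f (z $ 2) * pd 1 \<xi>1 z"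
  using has_differential_pd[OF dX1[unfolded eps1_def] assms] has_differential_pd[OF dX2[unfolded eps2_def] assms]
  by simp_all

text \<open>The form \<open>eps\<close> is xi1 dx1 + xi2 dx2, and dx1, dx2 are independent, with
  determinant p^2 times \<open>jacdet\<close>; so the coefficients of du can be compared.\<close>

lemma pd_U:
  assumes w: "w \<in> W"
  shows "pd 1 U w = \<xi>1 (Y w)" "pd 2 U w = \<xi>2 (Y w)"
proof -
  define z where "z = Y w"
  define P where "P = pfun f (z $ 2)"
  have z: "z \<in> V" "X z = w" using w by (auto simp: z_def Y_mem X_Y)
  have P: "P > 0" unfolding P_def by (rule pfun_pos[OF r_range[OF z(1)]])
  have "(U has_derivative (\<lambda>v. pd 1 U w * v $ 1 + pd 2 U w * v $ 2)) (at (X z))"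
    unfolding z(2) by (rule smooth_on_has_derivative[OF open_W U_smooth w])
  note chain = pd_compose[OF open_V X_smooth z(1) this]
  have dU': "pd 1 (\<lambda>z. U (X z)) z = \<xi>1 z * (P * pd 2 \<xi>2 z) + \<xi>2 z * - (P * pd 2 \<xi>1 z)"
    "pd 2 (\<lambda>z. U (X z)) z = \<xi>1 z * - (P * pd 1 \<xi>2 z) + \<xi>2 z * (P * pd 1 \<xi>1 z)"
    using has_differential_pd[OF dU[unfolded eps_def] z(1)] by (simp_all add: eps1_def eps2_def P_def)
  have e1: "(pd 1 U w - \<xi>1 z) * (P * pd 2 \<xi>2 z) + (pd 2 U w - \<xi>2 z) * - (P * pd 2 \<xi>1 z) = 0"
    using chain[of 1] dU'(1) by (simp add: pd_X[OF z(1)] P_def[symmetric] left_diff_distrib)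
  have e2: "(pd 1 U w - \<xi>1 z) * - (P * pd 1 \<xi>2 z) + (pd 2 U w - \<xi>2 z) * (P * pd 1 \<xi>1 z) = 0"
    using chain[of 2] dU'(2) by (simp add: pd_X[OF z(1)] P_def[symmetric] left_diff_distrib)
  have "P * pd 2 \<xi>2 z * (P * pd 1 \<xi>1 z) - - (P * pd 2 \<xi>1 z) * - (P * pd 1 \<xi>2 z) = P * P * jacdet \<xi>1 \<xi>2 z"
    by (simp add: jacdet_def algebra_simps)
  also have "\<dots> \<noteq> 0" using P jac_pos[OF z(1)] by simp
  finally have "P * pd 2 \<xi>2 z * (P * pd 1 \<xi>1 z) - - (P * pd 2 \<xi>1 z) * - (P * pd 1 \<xi>2 z) \<noteq> 0" .
  from linear_system_zero[OF e1 e2 this]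
  show "pd 1 U w = \<xi>1 (Y w)" "pd 2 U w = \<xi>2 (Y w)" by (simp_all add: z_def)
qed

text \<open>The intended a, b, c, d are the partials of xi1 and xi2 at \<open>Y w\<close>. The
  second derivatives then read \<open>U_ij = (H_i H_j + r_i r_j) / k\<close>: the Hessian metric is
  conformal to dH^2 + dr^2.\<close>

definition frame_at :: "real^2 \<Rightarrow> real \<Rightarrow> real \<Rightarrow> real \<Rightarrow> real \<Rightarrow> real \<Rightarrow> bool" where
  "frame_at w k a b c d \<longleftrightarrow> k > 0 \<and> a * d - b * c > 0 \<and> pfun f (Y w $ 2) * k * (a * d - b * c) = 1 \<and>
    pd 1 (\<lambda>w. Y w $ 1) w = k * a \<and> pd 2 (\<lambda>w. Y w $ 1) w = k * c \<and>
    pd 1 (\<lambda>w. Y w $ 2) w = k * b \<and> pd 2 (\<lambda>w. Y w $ 2) w = k * d \<and>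
    pd 1 (pd 1 U) w = k * (a * a + b * b) \<and> pd 2 (pd 2 U) w = k * (c * c + d * d) \<and>
    pd 1 (pd 2 U) w = k * (a * c + b * d) \<and> pd 2 (pd 1 U) w = k * (a * c + b * d)"

lemma frame_at_exists:
  assumes w: "w \<in> W"
  obtains k a b c d where "frame_at w k a b c d"
proof -
  define z where "z = Y w"
  define P where "P = pfun f (z $ 2)"
  have z: "z \<in> V" using w by (auto simp: z_def Y_mem)
  have P: "P > 0" unfolding P_def by (rule pfun_pos[OF r_range[OF z]])
  define a where "a = pd 1 \<xi>1 z"
  define b where "b = pd 2 \<xi>1 z"
  define c where "c = pd 1 \<xi>2 z"
  define d where "d = pd 2 \<xi>2 z"
  note defs = a_def b_def c_def d_def
  have D: "a * d - b * c > 0" using jac_pos[OF z] by (simp add: jacdet_def defs)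
  have inv: "\<And>w. w \<in> W \<Longrightarrow> Y w \<in> V \<and> X (Y w) = w" using Y_mem X_Y by blast
  note jac = inverse_pair_jacobian[OF open_V open_W X_smooth Y_smooth inv w]
  let ?H = "\<lambda>i. pd i (\<lambda>w. Y w $ 1) w" and ?r = "\<lambda>i. pd i (\<lambda>w. Y w $ 2) w"
  have "P * d * ?H 1 - P * c * ?r 1 = 1" "P * d * ?H 2 - P * c * ?r 2 = 0"
    "P * a * ?r 1 - P * b * ?H 1 = 0" "P * a * ?r 2 - P * b * ?H 2 = 1"
    using jac[of 1 1] jac[of 1 2] jac[of 2 1] jac[of 2 2]
    by (simp_all add: z_def[symmetric] pd_X[OF z] P_def[symmetric] defs)
  then obtain k where k: "k > 0" "P * k * (a * d - b * c) = 1"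
    "?H 1 = k * a" "?H 2 = k * c" "?r 1 = k * b" "?r 2 = k * d"
    by (rule conjugate_jacobian_inverse[OF _ _ _ _ D P])
  have der: "(\<xi>1 has_derivative (\<lambda>v. a * v $ 1 + b * v $ 2)) (at (Y w))"
    "(\<xi>2 has_derivative (\<lambda>v. c * v $ 1 + d * v $ 2)) (at (Y w))"
    unfolding defs z_def[symmetric] by (intro smooth_on_has_derivative[OF open_V] xi_smooth z)+
  have "pd i (pd 1 U) w = a * ?H i + b * ?r i" for i
    using pd_cong[OF open_W w pd_U(1)] pd_compose[OF open_W Y_smooth w der(1)] by simp
  moreover have "pd i (pd 2 U) w = c * ?H i + d * ?r i" for i
    using pd_cong[OF open_W w pd_U(2)] pd_compose[OF open_W Y_smooth w der(2)] by simp
  ultimately have "pd 1 (pd 1 U) w = k * (a * a + b * b)" "pd 2 (pd 2 U) w = k * (c * c + d * d)"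
    "pd 1 (pd 2 U) w = k * (a * c + b * d)" "pd 2 (pd 1 U) w = k * (a * c + b * d)"
    using k by (simp_all add: algebra_simps)
  then show ?thesis
    using that[of k a b c d] k D unfolding frame_at_def by (simp only: P_def z_def simp_thms)
qed

text \<open>By Lagrange's identity
  \<open>(a^2 + b^2) (c^2 + d^2) - (a c + b d)^2 = (a d - b c)^2\<close> the determinant is
  \<open>(k (a d - b c))^2\<close>, that is 1 / p^2.\<close>

lemma hessdet_U:
  assumes w: "w \<in> W"
  shows "hessdet U w = finv (Y w $ 2)" "hessdet U w > 0" "f (hessdet U w) = Y w $ 2"
proof -
  obtain k a b c d where F: "frame_at w k a b c d" by (rule frame_at_exists[OF w])
  then have k: "pfun f (Y w $ 2) * k * (a * d - b * c) = 1"
    and u: "pd 1 (pd 1 U) w = k * (a * a + b * b)" "pd 2 (pd 2 U) w = k * (c * c + d * d)"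
    "pd 1 (pd 2 U) w = k * (a * c + b * d)" "pd 2 (pd 1 U) w = k * (a * c + b * d)" by (auto simp only: frame_at_def)
  define P where "P = pfun f (Y w $ 2)"
  have r: "Y w $ 2 \<in> f ` {0<..}" using r_range Y_mem w by blast
  have "hessdet U w = (k * (a * d - b * c)) * (k * (a * d - b * c))"
    unfolding hessdet_2 u by (simp add: algebra_simps)
  then have "(P * P) * hessdet U w = (P * k * (a * d - b * c)) * (P * k * (a * d - b * c))"
    by (simp only: mult_ac)
  also have "\<dots> = 1" using k by (simp add: P_def)
  finally show eq: "hessdet U w = finv (Y w $ 2)"
    using finv_pos[OF r] by (simp add: P_def pfun_square[OF r] field_simps)
  show "hessdet U w > 0" "f (hessdet U w) = Y w $ 2"
    using finv_pos[OF r] f_finv[OF r] by (simp_all add: eq)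
qed

lemma pd_U_pos: "w \<in> W \<Longrightarrow> pd 1 (pd 1 U) w > 0"
proof -
  assume "w \<in> W"
  then obtain k a b c d where F: "frame_at w k a b c d" by (rule frame_at_exists)
  then have k: "k > 0" "a * d - b * c > 0"
    "pd 1 (pd 1 U) w = k * (a * a + b * b)" by (auto simp only: frame_at_def)
  then have "a \<noteq> 0 \<or> b \<noteq> 0" by auto
  then have "a * a + b * b > 0" by (simp add: sum_squares_gt_zero_iff)
  then show ?thesis using k by simp
qed

lemma pd_f_hessdet:
  assumes w: "w \<in> W"
  shows "pd i (\<lambda>w. f (hessdet U w)) w = pd i (\<lambda>w. Y w $ 2) w"
  by (rule pd_cong[OF open_W w hessdet_U(3)])

text \<open>Two uses: equation (2) becomes symmetry of the mixed partials of \<open>Y w $ 1\<close>,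
  and in (b) any two H-coordinates for the same \<open>u\<close> get the same differential.\<close>

lemma flux_eq_pd_Y:
  assumes w: "w \<in> W"
  shows "flux2 \<psi> U w = pd 1 (\<lambda>w. Y w $ 1) w" "flux1 \<psi> U w = - pd 2 (\<lambda>w. Y w $ 1) w"
proof -
  obtain k a b c d where F: "frame_at w k a b c d" by (rule frame_at_exists[OF w])
  then have k: "pfun f (Y w $ 2) * k * (a * d - b * c) = 1"
    and Y: "pd 1 (\<lambda>w. Y w $ 1) w = k * a" "pd 2 (\<lambda>w. Y w $ 1) w = k * c"
    "pd 1 (\<lambda>w. Y w $ 2) w = k * b" "pd 2 (\<lambda>w. Y w $ 2) w = k * d"
    and u: "pd 1 (pd 1 U) w = k * (a * a + b * b)" "pd 2 (pd 2 U) w = k * (c * c + d * d)"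
    "pd 1 (pd 2 U) w = k * (a * c + b * d)" by (auto simp only: frame_at_def)
  define P where "P = pfun f (Y w $ 2)"
  have g: "pd i (\<lambda>w. deriv \<psi> (hessdet U w)) w = P * pd i (\<lambda>w. Y w $ 2) w" for i
    using pd_deriv_psi_compose[OF open_W smooth_on_hessdet[OF open_W U_smooth] hessdet_U(2) w]
    by (simp add: hessdet_U(3)[OF w] pd_f_hessdet[OF w] P_def)
  have "flux2 \<psi> U w = k * a * (P * k * (a * d - b * c))"
    unfolding flux2_def g u Y by (simp add: algebra_simps)
  then show "flux2 \<psi> U w = pd 1 (\<lambda>w. Y w $ 1) w" using k by (simp add: P_def Y)
  have "flux1 \<psi> U w = - (k * c * (P * k * (a * d - b * c)))"
    unfolding flux1_def g u Y by (simp add: algebra_simps)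
  then show "flux1 \<psi> U w = - pd 2 (\<lambda>w. Y w $ 1) w" using k by (simp add: P_def Y)
qed

text \<open>The gradient of \<open>f(J)\<close> is \<open>k (b, d)\<close>, which cannot vanish when
  \<open>a d - b c > 0\<close>.\<close>

lemma ordinary_U:
  assumes w: "w \<in> W"
  shows "ordinary U w"
proof (rule ccontr)
  assume "\<not> ordinary U w"
  then have "pd i (hessdet U) w = 0" for i by (simp add: ordinary_def vec_eq_iff)
  then have "pd i (\<lambda>w. Y w $ 2) w = 0" for i
    using smooth_on_f_compose(2)[OF open_W smooth_on_hessdet[OF open_W U_smooth] hessdet_U(2) w]
    by (simp add: pd_f_hessdet[OF w])
  obtain k a b c d where F: "frame_at w k a b c d" by (rule frame_at_exists[OF w])
  then have F': "k > 0" "a * d - b * c > 0"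
    "pd 1 (\<lambda>w. Y w $ 2) w = k * b" "pd 2 (\<lambda>w. Y w $ 2) w = k * d" by (auto simp only: frame_at_def)
  with \<open>\<And>i. pd i (\<lambda>w. Y w $ 2) w = 0\<close> show False by simp
qed

lemma eq2_U: "eq2 \<psi> W U"
proof (rule iffD2[OF eq2_iff_flux[OF psi_smooth open_W U_smooth]], goal_cases)
  case 2
  show ?case
  proof
    fix w assume w: "w \<in> W"
    have "pd 1 (flux1 \<psi> U) w = pd 1 (\<lambda>w. - pd 2 (\<lambda>w. Y w $ 1) w) w"
      by (rule pd_cong[OF open_W w flux_eq_pd_Y(2)])
    also have "\<dots> = - pd 1 (pd 2 (\<lambda>w. Y w $ 1)) w"
      by (rule pd_minus[OF open_W smooth_on_pd[OF Y_smooth] w])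
    finally have "pd 1 (flux1 \<psi> U) w = \<dots>" .
    moreover have "pd 2 (flux2 \<psi> U) w = pd 2 (pd 1 (\<lambda>w. Y w $ 1)) w"
      by (rule pd_cong[OF open_W w flux_eq_pd_Y(1)])
    ultimately show "pd 1 (flux1 \<psi> U) w + pd 2 (flux2 \<psi> U) w = 0"
      using pd_commute[OF open_W Y_smooth w] by simp
  qed
qed (rule hessdet_U(2))

end

context density
begin

lemma eq3D:
  assumes S: "open S" "\<And>z. z \<in> S \<Longrightarrow> z $ 2 \<in> f ` {0<..}" and eq: "eq3 (pfun f) S \<xi>" and z: "z \<in> S"
  shows "pd 2 (\<lambda>w. pfun f (w $ 2) * pd 2 \<xi> w) z = pd 1 (\<lambda>w. - (pfun f (w $ 2) * pd 1 \<xi> w)) z"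
proof -
  have \<xi>: "smooth_on S \<xi>" using eq by (simp add: eq3_def)
  note p = smooth_on_pfun[OF S]
  have "pd 1 (\<lambda>w. pfun f (w $ 2) * pd 1 \<xi> w) z = pfun f (z $ 2) * pd 1 (pd 1 \<xi>) z"
    using pd_mult[OF S(1) p smooth_on_pd[OF \<xi>] z, of 1] by simp
  then have "pd 1 (\<lambda>w. - (pfun f (w $ 2) * pd 1 \<xi> w)) z = - (pfun f (z $ 2) * pd 1 (pd 1 \<xi>) z)"
    using pd_minus[OF S(1) smooth_on_mult[OF S(1) p smooth_on_pd[OF \<xi>]] z, of 1] by simp
  then show ?thesis
    using eq z pfun_pos[OF S(2)[OF z]] by (auto simp: eq3_def field_simps)
qed

text \<open>With a conjugate function \<open>g\<close>, (3) is the equality of the mixed partials of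
  \<open>g\<close>. It is used with \<open>g\<close> = x1 for xi2 and with \<open>g\<close> = -x2
  for xi1.\<close>

lemma eq3I_conjugate:
  assumes S: "open S" "\<And>z. z \<in> S \<Longrightarrow> z $ 2 \<in> f ` {0<..}" and \<xi>: "smooth_on S \<xi>" and g: "smooth_on S g"
    and g1: "\<And>z. z \<in> S \<Longrightarrow> pd 1 g z = pfun f (z $ 2) * pd 2 \<xi> z"
    and g2: "\<And>z. z \<in> S \<Longrightarrow> pd 2 g z = - (pfun f (z $ 2) * pd 1 \<xi> z)"
  shows "eq3 (pfun f) S \<xi>"
  unfolding eq3_def
proof (intro conjI ballI \<xi>)
  fix z assume z: "z \<in> S"
  note p = smooth_on_pfun[OF S]
  show "(\<lambda>t. pfun f ((z + t *\<^sub>R axis 2 1) $ 2) * pd 2 \<xi> (z + t *\<^sub>R axis 2 1)) differentiable at 0"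
    by (rule smooth_onD(2)[OF smooth_on_mult[OF S(1) p smooth_on_pd[OF \<xi>]] z])
  have "pd 2 (\<lambda>w. pfun f (w $ 2) * pd 2 \<xi> w) z = pd 2 (pd 1 g) z"
    by (rule pd_cong[OF S(1) z]) (simp add: g1)
  also have "\<dots> = pd 1 (pd 2 g) z" by (rule pd_commute[OF S(1) g z])
  also have "\<dots> = pd 1 (\<lambda>w. - (pfun f (w $ 2) * pd 1 \<xi> w)) z"
    by (rule pd_cong[OF S(1) z]) (simp add: g2)
  also have "\<dots> = - (pfun f (z $ 2) * pd 1 (pd 1 \<xi>) z)"
    using pd_minus[OF S(1) smooth_on_mult[OF S(1) p smooth_on_pd[OF \<xi>]] z, of 1]
      pd_mult[OF S(1) p smooth_on_pd[OF \<xi>] z, of 1] by simp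
  finally show "pd 1 (pd 1 \<xi>) z + 1 / pfun f (z $ 2) * pd 2 (\<lambda>w. pfun f (w $ 2) * pd 2 \<xi> w) z = 0"
    using pfun_pos[OF S(2)[OF z]] by simp
qed

end

text \<open>A1, A2 and B1, B2 are the (H, r)-derivatives of x1 and x2. With
  \<open>M = P [[u12, u22], [-u11, -u12]]\<close> the first assumptions say dH = -dr M, and the one
  on \<open>P * P\<close> says M^2 = -1; dually M sends the r-derivative of x to its H-derivative.
  The last claim is the product of the Hessian determinant and the Jacobian of x in (H, r).\<close>

lemma inverse_coordinates_conjugate:
  fixes u11 u12 u22 :: real
  assumes H: "H1 = P * (r2 * u11 - r1 * u12)" "H2 = P * (r2 * u12 - r1 * u22)"
    and P: "P * P * (u11 * u22 - u12 * u12) = 1" and D: "H1 * r2 - H2 * r1 > 0"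
    and J: "u11 * u22 - u12 * u12 > 0"
    and sys: "H1 * A1 + H2 * B1 = 1" "r1 * A1 + r2 * B1 = 0" "H1 * A2 + H2 * B2 = 0" "r1 * A2 + r2 * B2 = 1"
  shows "A1 = P * (u12 * A2 + u22 * B2)" "A2 = - (P * (u12 * A1 + u22 * B1))"
    "B1 = - (P * (u11 * A2 + u12 * B2))" "B2 = P * (u11 * A1 + u12 * B1)"
    "(u11 * A1 + u12 * B1) * (u12 * A2 + u22 * B2) - (u11 * A2 + u12 * B2) * (u12 * A1 + u22 * B1) > 0"
proof -
  define k where "k = inverse (H1 * r2 - H2 * r1)"
  have k: "k * (H1 * r2 - H2 * r1) = 1" "k > 0" using D by (auto simp: k_def)
  have e: "k * (H1 * r2 - H2 * r1) * A1 = k * (r2 * (H1 * A1 + H2 * B1) - H2 * (r1 * A1 + r2 * B1))"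
    "k * (H1 * r2 - H2 * r1) * B1 = k * (H1 * (r1 * A1 + r2 * B1) - r1 * (H1 * A1 + H2 * B1))"
    "k * (H1 * r2 - H2 * r1) * A2 = k * (r2 * (H1 * A2 + H2 * B2) - H2 * (r1 * A2 + r2 * B2))"
    "k * (H1 * r2 - H2 * r1) * B2 = k * (H1 * (r1 * A2 + r2 * B2) - r1 * (H1 * A2 + H2 * B2))"
    by (simp_all add: algebra_simps)
  have s: "A1 = k * r2" "B1 = - (k * r1)" "A2 = - (k * H2)" "B2 = k * H1"
    using e[unfolded sys k(1)] by simp_all
  have "P * (u12 * A2 + u22 * B2) = k * r2 * (P * P * (u11 * u22 - u12 * u12))"
    unfolding s(3,4) H by (simp add: algebra_simps)
  then show "A1 = P * (u12 * A2 + u22 * B2)" using P s(1) by simp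
  show "A2 = - (P * (u12 * A1 + u22 * B1))" "B2 = P * (u11 * A1 + u12 * B1)"
    unfolding s H by (simp_all add: algebra_simps)
  have "- (P * (u11 * A2 + u12 * B2)) = - (k * r1 * (P * P * (u11 * u22 - u12 * u12)))"
    unfolding s(3,4) H by (simp add: algebra_simps)
  then show "B1 = - (P * (u11 * A2 + u12 * B2))" using P s(2) by simp
  have "(u11 * A1 + u12 * B1) * (u12 * A2 + u22 * B2) - (u11 * A2 + u12 * B2) * (u12 * A1 + u22 * B1)
      = (u11 * u22 - u12 * u12) * (A1 * B2 - A2 * B1)"
    by (simp add: algebra_simps)
  also have "A1 * B2 - A2 * B1 = k * (k * (H1 * r2 - H2 * r1))"
    unfolding s by (simp add: algebra_simps)
  also have "\<dots> = k" using k(1) by simp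
  finally show "(u11 * A1 + u12 * B1) * (u12 * A2 + u22 * B2) - (u11 * A2 + u12 * B2) * (u12 * A1 + u22 * B1) > 0"
    using J k(2) by simp
qed

lemma closed_formI:
  assumes "smooth_on S a" "smooth_on S b" "\<And>z. z \<in> S \<Longrightarrow> pd 2 a z = pd 1 b z"
  shows "closed_form S (a, b)"
  using smooth_onD(2)[OF assms(1)] smooth_onD(2)[OF assms(2)] assms(3) by (simp add: closed_form_def)

lemma wedge_eps: "wedge (eps1 p \<xi>1 \<xi>2) (eps2 p \<xi>1 \<xi>2) z = p (z $ 2) * p (z $ 2) * jacdet \<xi>1 \<xi>2 z"
  by (simp add: wedge_def eps1_def eps2_def jacdet_def algebra_simps)

section \<open>Closedness of the three forms and the local construction of u\<close>

context density
begin

context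
  fixes S :: "(real^2) set" and \<xi>1 \<xi>2 :: "real^2 \<Rightarrow> real"
  assumes S: "open S" and r: "\<And>z. z \<in> S \<Longrightarrow> z $ 2 \<in> f ` {0<..}"
    and \<xi>1: "eq3 (pfun f) S \<xi>1" and \<xi>2: "eq3 (pfun f) S \<xi>2"
begin

lemma eq3_smooth: "smooth_on S \<xi>1" "smooth_on S \<xi>2"
  using \<xi>1 \<xi>2 by (auto simp: eq3_def)

lemma smooth_pfun_pd:
  "smooth_on S (\<lambda>z. pfun f (z $ 2) * pd i \<xi>1 z)" "smooth_on S (\<lambda>z. pfun f (z $ 2) * pd i \<xi>2 z)"
  by (intro smooth_on_mult smooth_on_pd smooth_on_pfun S r eq3_smooth; assumption)+

lemma smooth_eps:
  "smooth_on S (fst (eps1 (pfun f) \<xi>1 \<xi>2))" "smooth_on S (snd (eps1 (pfun f) \<xi>1 \<xi>2))"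
  "smooth_on S (fst (eps2 (pfun f) \<xi>1 \<xi>2))" "smooth_on S (snd (eps2 (pfun f) \<xi>1 \<xi>2))"
  "smooth_on S (fst (eps (pfun f) \<xi>1 \<xi>2))" "smooth_on S (snd (eps (pfun f) \<xi>1 \<xi>2))"
  by (simp_all add: eps_def eps1_def eps2_def)
    (intro smooth_on_add smooth_on_diff smooth_on_minus S smooth_on_mult[OF S eq3_smooth(1)] smooth_on_mult[OF S eq3_smooth(2)] smooth_pfun_pd)+

lemma closed_eps1: "closed_form S (eps1 (pfun f) \<xi>1 \<xi>2)"
  unfolding eps1_def using eq3D[OF S r \<xi>2]
  by (intro closed_formI smooth_on_minus smooth_pfun_pd S) auto

lemma closed_eps2: "closed_form S (eps2 (pfun f) \<xi>1 \<xi>2)"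
  unfolding eps2_def
proof (intro closed_formI smooth_on_minus smooth_pfun_pd S)
  fix z assume z: "z \<in> S"
  show "pd 2 (\<lambda>z. - (pfun f (z $ 2) * pd 2 \<xi>1 z)) z = pd 1 (\<lambda>z. pfun f (z $ 2) * pd 1 \<xi>1 z) z"
    using eq3D[OF S r \<xi>1 z] pd_minus[OF S smooth_pfun_pd(1) z] by simp
qed

text \<open>In the differential of \<open>eps\<close> the terms with d eps1 and d eps2 vanish by
  closedness, and \<open>d xi1 \<and> eps1 + d xi2 \<and> eps2\<close> vanishes identically, since
  the same products occur with opposite signs.\<close>

lemma closed_eps: "closed_form S (eps (pfun f) \<xi>1 \<xi>2)"
proof -
  let ?a1 = "fst (eps1 (pfun f) \<xi>1 \<xi>2)" and ?b1 = "snd (eps1 (pfun f) \<xi>1 \<xi>2)"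
  let ?a2 = "fst (eps2 (pfun f) \<xi>1 \<xi>2)" and ?b2 = "snd (eps2 (pfun f) \<xi>1 \<xi>2)"
  have "closed_form S (\<lambda>z. \<xi>1 z * ?a1 z + \<xi>2 z * ?a2 z, \<lambda>z. \<xi>1 z * ?b1 z + \<xi>2 z * ?b2 z)"
  proof (intro closed_formI smooth_on_add smooth_on_mult S eq3_smooth smooth_eps)
    fix z assume z: "z \<in> S"
    have pd: "pd i (\<lambda>z. \<xi>1 z * a z + \<xi>2 z * b z) z
        = pd i \<xi>1 z * a z + \<xi>1 z * pd i a z + (pd i \<xi>2 z * b z + \<xi>2 z * pd i b z)"
      if "smooth_on S a" "smooth_on S b" for i a b
      using pd_add[OF S smooth_on_mult[OF S eq3_smooth(1) that(1)] smooth_on_mult[OF S eq3_smooth(2) that(2)] z]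
        pd_mult[OF S eq3_smooth(1) that(1) z] pd_mult[OF S eq3_smooth(2) that(2) z] by simp
    have "pd 2 ?a1 z = pd 1 ?b1 z" "pd 2 ?a2 z = pd 1 ?b2 z"
      using closed_eps1 closed_eps2 z by (auto simp: closed_form_def)
    moreover have "pd 2 \<xi>1 z * ?a1 z + pd 2 \<xi>2 z * ?a2 z = pd 1 \<xi>1 z * ?b1 z + pd 1 \<xi>2 z * ?b2 z"
      by (simp add: eps1_def eps2_def)
    ultimately show "pd 2 (\<lambda>z. \<xi>1 z * ?a1 z + \<xi>2 z * ?a2 z) z = pd 1 (\<lambda>z. \<xi>1 z * ?b1 z + \<xi>2 z * ?b2 z) z"
      by (simp add: pd smooth_eps)
  qed
  then show ?thesis by (simp add: eps_def)
qed

lemma open_jacdet_pos: "open (S \<inter> jacdet \<xi>1 \<xi>2 -` {0<..})"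
proof -
  have "smooth_on S (jacdet \<xi>1 \<xi>2)"
    unfolding jacdet_def[abs_def] by (intro smooth_on_diff smooth_on_mult smooth_on_pd eq3_smooth S)
  then show ?thesis
    by (intro continuous_open_preimage smooth_on_continuous_on S) auto
qed

lemma hodograph_construction:
  assumes z0: "z0 \<in> S" "jacdet \<xi>1 \<xi>2 z0 > 0"
  obtains V W u X Y where "z0 \<in> V" "V \<subseteq> S" "convex W" "smooth_on V u"
    "has_differential u (eps (pfun f) \<xi>1 \<xi>2) V" "hodograph \<psi> f V W X Y \<xi>1 \<xi>2 (u \<circ> Y)"
proof -
  \<comment> \<open>The Jacobian is assumed positive at \<open>z0\<close>; continuity gives an open
    set on which it stays positive.\<close>
  define S1 where "S1 = S \<inter> jacdet \<xi>1 \<xi>2 -` {0<..}"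
  have S1: "open S1" "z0 \<in> S1" "S1 \<subseteq> S" "\<And>z. z \<in> S1 \<Longrightarrow> jacdet \<xi>1 \<xi>2 z > 0"
    using open_jacdet_pos z0 by (auto simp: S1_def)
  have prim: "\<exists>e g. e > 0 \<and> ball z0 e \<subseteq> S1 \<and> has_differential g \<omega> (ball z0 e) \<and> smooth_on (ball z0 e) g"
    if "closed_form S \<omega>" "smooth_on S (fst \<omega>)" "smooth_on S (snd \<omega>)" for \<omega>
  proof -
    have "\<And>w. w \<in> S1 \<Longrightarrow> pd 2 (fst \<omega>) w = pd 1 (snd \<omega>) w"
      using that(1) S1(3) by (auto simp: closed_form_def)
    from closed_form_has_primitive[OF S1(1,2) smooth_on_subset[OF that(2) S1(3)] smooth_on_subset[OF that(3) S1(3)] this]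
    show ?thesis by (metis prod.collapse)
  qed
  obtain e1 X1 where 1: "e1 > 0" "ball z0 e1 \<subseteq> S1" "has_differential X1 (eps1 (pfun f) \<xi>1 \<xi>2) (ball z0 e1)"
    "smooth_on (ball z0 e1) X1"
    using prim[OF closed_eps1 smooth_eps(1,2)] by blast
  obtain e2 X2 where 2: "e2 > 0" "has_differential X2 (eps2 (pfun f) \<xi>1 \<xi>2) (ball z0 e2)"
    "smooth_on (ball z0 e2) X2"
    using prim[OF closed_eps2 smooth_eps(3,4)] by blast
  obtain e3 u where 3: "e3 > 0" "has_differential u (eps (pfun f) \<xi>1 \<xi>2) (ball z0 e3)"
    "smooth_on (ball z0 e3) u"
    using prim[OF closed_eps smooth_eps(5,6)] by blast
  \<comment> \<open>The three primitives live on concentric balls; the smallest one serves all of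
    them.\<close>
  define B where "B = ball z0 (min e1 (min e2 e3))"
  have B: "open B" "z0 \<in> B" "B \<subseteq> ball z0 e1" "B \<subseteq> ball z0 e2" "B \<subseteq> ball z0 e3"
    using 1 2 3 by (auto simp: B_def)
  have BS1: "B \<subseteq> S1" using B 1 by blast
  define X where "X = (\<lambda>z. pt (X1 z) (X2 z))"
  have dX: "has_differential (\<lambda>z. X z $ 1) (eps1 (pfun f) \<xi>1 \<xi>2) B"
    "has_differential (\<lambda>z. X z $ 2) (eps2 (pfun f) \<xi>1 \<xi>2) B"
    using has_differential_subset[OF 1(3) B(3)] has_differential_subset[OF 2(2) B(4)] by (simp_all add: X_def)
  have X: "smooth_on B (\<lambda>z. X z $ i)" for i
    using smooth_on_subset[OF 1(4) B(3)] smooth_on_subset[OF 2(3) B(4)] exhaust_2[of i] by (auto simp: X_def)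
  have u: "has_differential u (eps (pfun f) \<xi>1 \<xi>2) B" "smooth_on B u"
    using has_differential_subset[OF 3(2) B(5)] smooth_on_subset[OF 3(3) B(5)] .
  have "jacdet (\<lambda>z. X z $ 1) (\<lambda>z. X z $ 2) z \<noteq> 0" if "z \<in> B" for z
  proof -
    have "jacdet (\<lambda>z. X z $ 1) (\<lambda>z. X z $ 2) z = wedge (eps1 (pfun f) \<xi>1 \<xi>2) (eps2 (pfun f) \<xi>1 \<xi>2) z"
      unfolding jacdet_def wedge_def
      using has_differential_pd[OF dX(1)[unfolded eps1_def] that] has_differential_pd[OF dX(2)[unfolded eps2_def] that]
      by (simp add: eps1_def eps2_def)
    moreover have "z \<in> S1" using that BS1 by blast
    ultimately show ?thesis using S1(4)[of z] pfun_pos[OF r, of z] S1(3) by (auto simp: wedge_eps)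
  qed
  from smooth_local_inverse[OF B(1,2) X this] obtain V e Y where V: "open V" "z0 \<in> V" "V \<subseteq> B" "e > 0"
    "homeomorphism V (ball (X z0) e) X Y" and Y: "\<And>i. smooth_on (ball (X z0) e) (\<lambda>w. Y w $ i)"
    by metis
  define W where "W = ball (X z0) e"
  have hom: "homeomorphism V W X Y" using V by (simp add: W_def)
  have YV: "\<And>w. w \<in> W \<Longrightarrow> Y w \<in> V" and YX: "\<And>z. z \<in> V \<Longrightarrow> Y (X z) = z"
    using hom by (auto simp: homeomorphism_def)
  have VS1: "V \<subseteq> S1" using V(3) BS1 by blast
  have uV: "has_differential u (eps (pfun f) \<xi>1 \<xi>2) V" by (rule has_differential_subset[OF u(1) V(3)])
  have "hodograph \<psi> f V W X Y \<xi>1 \<xi>2 (u \<circ> Y)"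
  proof
    show "open V" "open W" "homeomorphism V W X Y" using V hom by (auto simp: W_def)
    show "smooth_on V (\<lambda>z. X z $ i)" for i by (rule smooth_on_subset[OF X V(3)])
    show Y': "smooth_on W (\<lambda>w. Y w $ i)" for i using Y by (simp add: W_def)
    show "z $ 2 \<in> f ` {0<..}" if "z \<in> V" for z using that VS1 S1(3) by (intro r) blast
    show "jacdet \<xi>1 \<xi>2 z > 0" if "z \<in> V" for z using that VS1 by (intro S1(4)) blast
    show "smooth_on V \<xi>1" "smooth_on V \<xi>2"
      using VS1 S1(3) by (auto intro: smooth_on_subset[OF eq3_smooth(1)] smooth_on_subset[OF eq3_smooth(2)])
    show "has_differential (\<lambda>z. X z $ 1) (eps1 (pfun f) \<xi>1 \<xi>2) V"
      "has_differential (\<lambda>z. X z $ 2) (eps2 (pfun f) \<xi>1 \<xi>2) V"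
      by (rule has_differential_subset[OF dX(1) V(3)] has_differential_subset[OF dX(2) V(3)])+
    have "smooth_on W (\<lambda>w. u (Y w))"
      by (rule smooth_on_compose[OF _ V(1) smooth_on_subset[OF u(2) V(3)] Y' YV]) (auto simp: W_def)
    then show "smooth_on W (u \<circ> Y)" by (simp add: o_def)
    show "has_differential (\<lambda>z. (u \<circ> Y) (X z)) (eps (pfun f) \<xi>1 \<xi>2) V"
      using uV unfolding eps_def by (rule has_differential_cong[OF V(1)]) (simp_all add: YX)
  qed
  moreover have "convex W" by (simp add: W_def)
  moreover have "V \<subseteq> S" using VS1 S1(3) by blast
  ultimately show ?thesis
    using that[of V W u X Y] V(2) uV smooth_on_subset[OF u(2) V(3)] by blast
qed

end

end

section \<open>From equation (2) to equation (3)\<close>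

context density
begin

context
  fixes \<Omega> :: "(real^2) set" and u :: "real^2 \<Rightarrow> real" and x0 :: "real^2"
  assumes \<Omega>: "open \<Omega>" and x0: "x0 \<in> \<Omega>" and u: "smooth_on \<Omega> u" and conv: "convex_on \<Omega> u"
    and J: "\<And>x. x \<in> \<Omega> \<Longrightarrow> hessdet u x > 0" and eq: "eq2 \<psi> \<Omega> u" and ord: "ordinary u x0"
begin

lemma smooth_hess: "smooth_on \<Omega> (hessdet u)"
  by (rule smooth_on_hessdet[OF \<Omega> u])

lemma flux_eq_pd_r:
  assumes "x \<in> \<Omega>"
  shows "flux2 \<psi> u x = pfun f (f (hessdet u x)) *
      (pd 2 (\<lambda>x. f (hessdet u x)) x * pd 1 (pd 1 u) x - pd 1 (\<lambda>x. f (hessdet u x)) x * pd 1 (pd 2 u) x)"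
    "- flux1 \<psi> u x = pfun f (f (hessdet u x)) *
      (pd 2 (\<lambda>x. f (hessdet u x)) x * pd 1 (pd 2 u) x - pd 1 (\<lambda>x. f (hessdet u x)) x * pd 2 (pd 2 u) x)"
  using pd_deriv_psi_compose[OF \<Omega> smooth_hess J assms]
  by (simp_all add: flux1_def flux2_def algebra_simps)

lemma pd_r_nonzero: "pd 1 (\<lambda>x. f (hessdet u x)) x0 \<noteq> 0 \<or> pd 2 (\<lambda>x. f (hessdet u x)) x0 \<noteq> 0"
proof -
  have "pd 1 (hessdet u) x0 \<noteq> 0 \<or> pd 2 (hessdet u) x0 \<noteq> 0"
    using ord by (auto simp: ordinary_def vec_eq_iff forall_2)
  then show ?thesis
    using smooth_on_f_compose(2)[OF \<Omega> smooth_hess J x0] psi_pos[OF J[OF x0]] J[OF x0] by auto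
qed

lemma hodograph_coordinates:
  obtains W V and \<Phi> Y :: "real^2 \<Rightarrow> real^2" where "open W" "x0 \<in> W" "W \<subseteq> \<Omega>" "open V" "homeomorphism W V \<Phi> Y"
    "\<forall>i. smooth_on W (\<lambda>x. \<Phi> x $ i)" "\<forall>i. smooth_on V (\<lambda>z. Y z $ i)"
    "\<forall>x\<in>W. \<Phi> x $ 2 = f (hessdet u x)"
    "\<forall>x\<in>W. pd 1 (\<lambda>x. \<Phi> x $ 1) x = flux2 \<psi> u x"
    "\<forall>x\<in>W. pd 2 (\<lambda>x. \<Phi> x $ 1) x = - flux1 \<psi> u x"
    "\<forall>x\<in>W. jacdet (\<lambda>x. \<Phi> x $ 1) (\<lambda>x. \<Phi> x $ 2) x > 0"
proof -
  note flux = smooth_on_flux[OF psi_smooth \<Omega> u J]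
  have closed: "pd 2 (flux2 \<psi> u) x = pd 1 (\<lambda>x. - flux1 \<psi> u x) x" if "x \<in> \<Omega>" for x
    using eq eq2_iff_flux[OF psi_smooth \<Omega> u J] pd_minus[OF \<Omega> flux(1) that, of 1] that
    by (auto simp: eq_neg_iff_add_eq_0 add.commute)
  obtain e H where e: "e > 0" "ball x0 e \<subseteq> \<Omega>"
    and H: "has_differential H (flux2 \<psi> u, \<lambda>x. - flux1 \<psi> u x) (ball x0 e)" "smooth_on (ball x0 e) H"
    by (rule closed_form_has_primitive[OF \<Omega> x0 flux(2) smooth_on_minus[OF \<Omega> flux(1)] closed])
  define B where "B = ball x0 e"
  have B: "open B" "x0 \<in> B" "B \<subseteq> \<Omega>" using e by (auto simp: B_def)
  define \<Phi> where "\<Phi> = (\<lambda>x. pt (H x) (f (hessdet u x)))"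
  have \<Phi>: "smooth_on B (\<lambda>x. \<Phi> x $ i)" for i
    using H(2) smooth_on_subset[OF smooth_on_f_compose(1)[OF \<Omega> smooth_hess J] B(3)] exhaust_2[of i]
    by (auto simp: \<Phi>_def B_def)
  have pdH: "pd 1 (\<lambda>x. \<Phi> x $ 1) x = flux2 \<psi> u x" "pd 2 (\<lambda>x. \<Phi> x $ 1) x = - flux1 \<psi> u x" if "x \<in> B" for x
    using has_differential_pd[OF H(1)] that by (simp_all add: \<Phi>_def B_def)
  let ?j = "jacdet (\<lambda>x. \<Phi> x $ 1) (\<lambda>x. \<Phi> x $ 2)"
  have "?j x0 > 0"
  proof -
    let ?r = "\<lambda>i. pd i (\<lambda>x. f (hessdet u x)) x0"
    \<comment> \<open>The Hessian form at the rotated gradient (r_2, -r_1); the sign is moved into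
      the cross term to fit \<open>quadratic_form_pos\<close>.\<close>
    have "?j x0 = pfun f (f (hessdet u x0)) *
        (pd 1 (pd 1 u) x0 * (?r 2)\<^sup>2 + 2 * (- pd 1 (pd 2 u) x0) * ?r 2 * ?r 1 + pd 2 (pd 2 u) x0 * (?r 1)\<^sup>2)"
      unfolding jacdet_def pdH[OF B(2)] flux_eq_pd_r[OF x0]
      by (simp add: \<Phi>_def algebra_simps power2_eq_square)
    moreover have "pd 1 (pd 1 u) x0 * (?r 2)\<^sup>2 + 2 * (- pd 1 (pd 2 u) x0) * ?r 2 * ?r 1
        + pd 2 (pd 2 u) x0 * (?r 1)\<^sup>2 > 0"
      using J[OF x0] pd_commute[OF \<Omega> u x0] pd_r_nonzero
      by (intro quadratic_form_pos convex_on_imp_pd_pos[OF \<Omega> u conv x0]) (auto simp: hessdet_2)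
    moreover have "pfun f (f (hessdet u x0)) > 0" using J[OF x0] by (intro pfun_pos) auto
    ultimately show ?thesis by simp
  qed
  \<comment> \<open>Ordinariness is assumed at \<open>x0\<close>, so positivity of the Jacobian
    spreads to a neighbourhood by continuity.\<close>
  define B' where "B' = B \<inter> ?j -` {0<..}"
  have "smooth_on B ?j"
    unfolding jacdet_def[abs_def] by (intro smooth_on_diff smooth_on_mult smooth_on_pd \<Phi> B)
  then have "open B'"
    unfolding B'_def by (intro continuous_open_preimage smooth_on_continuous_on B) auto
  have "x0 \<in> B'" and sub: "B' \<subseteq> B" using \<open>?j x0 > 0\<close> B by (auto simp: B'_def)
  have pos: "?j x > 0" if "x \<in> B'" for x using that by (simp add: B'_def)
  obtain W e' Y where W: "open W" "x0 \<in> W" "W \<subseteq> B'" "e' > 0" "homeomorphism W (ball (\<Phi> x0) e') \<Phi> Y"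
    and Y: "\<And>i. smooth_on (ball (\<Phi> x0) e') (\<lambda>z. Y z $ i)"
    using smooth_local_inverse[OF \<open>open B'\<close> \<open>x0 \<in> B'\<close> smooth_on_subset[OF \<Phi> sub]
          less_imp_neq[OF pos, symmetric]] by metis
  have WB: "W \<subseteq> B" using W(3) sub by blast
  show ?thesis
  proof (rule that[OF W(1,2) _ open_ball W(5)]; (intro allI ballI)?)
    show "W \<subseteq> \<Omega>" using WB B(3) by blast
    show "smooth_on W (\<lambda>x. \<Phi> x $ i)" for i by (rule smooth_on_subset[OF \<Phi> WB])
    show "smooth_on (ball (\<Phi> x0) e') (\<lambda>z. Y z $ i)" for i by (rule Y)
    show "\<Phi> x $ 2 = f (hessdet u x)" for x by (simp add: \<Phi>_def)
    show "pd 1 (\<lambda>x. \<Phi> x $ 1) x = flux2 \<psi> u x" "pd 2 (\<lambda>x. \<Phi> x $ 1) x = - flux1 \<psi> u x"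
      if "x \<in> W" for x using pdH that WB by blast+
    show "?j x > 0" if "x \<in> W" for x using pos that W(3) by blast
  qed
qed

context
  fixes W V :: "(real^2) set" and \<Phi> Y :: "real^2 \<Rightarrow> real^2"
  assumes W: "open W" "W \<subseteq> \<Omega>" and V: "open V" and hom: "homeomorphism W V \<Phi> Y"
    and \<Phi>: "\<And>i. smooth_on W (\<lambda>x. \<Phi> x $ i)" and Y: "\<And>i. smooth_on V (\<lambda>z. Y z $ i)"
    and r: "\<And>x. x \<in> W \<Longrightarrow> \<Phi> x $ 2 = f (hessdet u x)"
    and pdH: "\<And>x. x \<in> W \<Longrightarrow> pd 1 (\<lambda>x. \<Phi> x $ 1) x = flux2 \<psi> u x"
      "\<And>x. x \<in> W \<Longrightarrow> pd 2 (\<lambda>x. \<Phi> x $ 1) x = - flux1 \<psi> u x"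
    and jac: "\<And>x. x \<in> W \<Longrightarrow> jacdet (\<lambda>x. \<Phi> x $ 1) (\<lambda>x. \<Phi> x $ 2) x > 0"
begin

lemma Y_mem: "z \<in> V \<Longrightarrow> Y z \<in> W" and \<Phi>_Y: "z \<in> V \<Longrightarrow> \<Phi> (Y z) = z" and Y_\<Phi>: "x \<in> W \<Longrightarrow> Y (\<Phi> x) = x"
  using hom by (auto simp: homeomorphism_def)

lemma V_range: "z \<in> V \<Longrightarrow> z $ 2 \<in> f ` {0<..}"
  using r[OF Y_mem] J W(2) Y_mem \<Phi>_Y by force

lemma smooth_u_Y: "smooth_on V (u \<circ> Y)" "smooth_on V (pd i u \<circ> Y)"
  unfolding o_def
  using smooth_on_compose[OF V \<Omega> u Y] smooth_on_compose[OF V \<Omega> smooth_on_pd[OF u] Y] Y_mem W(2) by blast+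

text \<open>The derivatives of x = Y z come from inverting the Jacobian matrix of
  \<open>\<Phi>\<close>; by the chain rule the combinations of second derivatives in
  \<open>inverse_coordinates_conjugate\<close> are the (H, r)-derivatives of
  \<open>pd i u \<circ> Y\<close>.\<close>

lemma conjugate_relations:
  assumes z: "z \<in> V"
  defines "P \<equiv> pfun f (z $ 2)"
  shows "pd 1 (\<lambda>z. Y z $ 1) z = P * pd 2 (pd 2 u \<circ> Y) z"
    "pd 2 (\<lambda>z. Y z $ 1) z = - (P * pd 1 (pd 2 u \<circ> Y) z)"
    "pd 1 (\<lambda>z. Y z $ 2) z = - (P * pd 2 (pd 1 u \<circ> Y) z)"
    "pd 2 (\<lambda>z. Y z $ 2) z = P * pd 1 (pd 1 u \<circ> Y) z"
    "jacdet (pd 1 u \<circ> Y) (pd 2 u \<circ> Y) z > 0"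
proof -
  define x where "x = Y z"
  have x: "x \<in> W" "x \<in> \<Omega>" "z = \<Phi> x" using z W(2) by (auto simp: x_def Y_mem \<Phi>_Y)
  let ?r = "\<lambda>i. pd i (\<lambda>x. \<Phi> x $ 2) x" and ?H = "\<lambda>i. pd i (\<lambda>x. \<Phi> x $ 1) x"
  let ?A = "\<lambda>i. pd i (\<lambda>z. Y z $ 1) z" and ?B = "\<lambda>i. pd i (\<lambda>z. Y z $ 2) z"
  have r': "pd i (\<lambda>x. f (hessdet u x)) x = ?r i" for i
    by (rule pd_cong[OF W(1) x(1)]) (simp add: r)
  have P: "P = pfun f (f (hessdet u x))" using r x by (simp add: P_def)
  have u12: "pd 2 (pd 1 u) x = pd 1 (pd 2 u) x" by (rule pd_commute[OF \<Omega> u x(2)])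
  have H: "?H 1 = P * (?r 2 * pd 1 (pd 1 u) x - ?r 1 * pd 1 (pd 2 u) x)"
    "?H 2 = P * (?r 2 * pd 1 (pd 2 u) x - ?r 1 * pd 2 (pd 2 u) x)"
    using pdH[OF x(1)] flux_eq_pd_r[OF x(2)] by (simp_all add: r' P)
  have det: "hessdet u x = pd 1 (pd 1 u) x * pd 2 (pd 2 u) x - pd 1 (pd 2 u) x * pd 1 (pd 2 u) x"
    by (simp add: hessdet_2 u12)
  have P2: "P * P * (pd 1 (pd 1 u) x * pd 2 (pd 2 u) x - pd 1 (pd 2 u) x * pd 1 (pd 2 u) x) = 1"
    unfolding det[symmetric] P using J[OF x(2)] pfun_square[of "f (hessdet u x)"] by simp
  have D: "?H 1 * ?r 2 - ?H 2 * ?r 1 > 0" using jac[OF x(1)] by (simp add: jacdet_def)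
  have inv: "\<And>z. z \<in> V \<Longrightarrow> Y z \<in> W \<and> \<Phi> (Y z) = z" using Y_mem \<Phi>_Y by blast
  note ipj = inverse_pair_jacobian[OF W(1) V \<Phi> Y inv z, folded x_def]
  have sys: "?H 1 * ?A 1 + ?H 2 * ?B 1 = 1" "?r 1 * ?A 1 + ?r 2 * ?B 1 = 0"
    "?H 1 * ?A 2 + ?H 2 * ?B 2 = 0" "?r 1 * ?A 2 + ?r 2 * ?B 2 = 1"
    using ipj[of 1 1] ipj[of 2 1] ipj[of 1 2] ipj[of 2 2] by simp_all
  have chain: "pd i (pd j u \<circ> Y) z = pd 1 (pd j u) x * ?A i + pd 2 (pd j u) x * ?B i" for i j
    using pd_compose[OF V Y z smooth_on_has_derivative[OF \<Omega> smooth_on_pd[OF u] x(2)[unfolded x_def]]]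
    by (simp add: o_def x_def)
  note rel = inverse_coordinates_conjugate[OF H P2 D J[OF x(2), unfolded det] sys]
  show "?A 1 = P * pd 2 (pd 2 u \<circ> Y) z" "?A 2 = - (P * pd 1 (pd 2 u \<circ> Y) z)"
    "?B 1 = - (P * pd 2 (pd 1 u \<circ> Y) z)" "?B 2 = P * pd 1 (pd 1 u \<circ> Y) z"
    "jacdet (pd 1 u \<circ> Y) (pd 2 u \<circ> Y) z > 0"
    unfolding chain jacdet_def u12 using rel by blast+
qed

lemma coordinates_eq3: "eq3 (pfun f) V (pd 1 u \<circ> Y)" "eq3 (pfun f) V (pd 2 u \<circ> Y)"
proof -
  show "eq3 (pfun f) V (pd 2 u \<circ> Y)"
    by (rule eq3I_conjugate[OF V V_range smooth_u_Y(2) Y conjugate_relations(1,2)])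
  show "eq3 (pfun f) V (pd 1 u \<circ> Y)"
    by (rule eq3I_conjugate[OF V V_range smooth_u_Y(2) smooth_on_minus[OF V Y[of 2]]])
      (simp_all add: conjugate_relations(3,4) pd_minus[OF V Y])
qed

lemma coordinates_differentials:
  "has_differential (u \<circ> Y) (eps (pfun f) (pd 1 u \<circ> Y) (pd 2 u \<circ> Y)) V"
  "has_differential (\<lambda>z. Y z $ 1) (eps1 (pfun f) (pd 1 u \<circ> Y) (pd 2 u \<circ> Y)) V"
  "has_differential (\<lambda>z. Y z $ 2) (eps2 (pfun f) (pd 1 u \<circ> Y) (pd 2 u \<circ> Y)) V"
proof -
  have chain: "pd i (u \<circ> Y) z = pd 1 u (Y z) * pd i (\<lambda>z. Y z $ 1) z + pd 2 u (Y z) * pd i (\<lambda>z. Y z $ 2) z"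
    if z: "z \<in> V" for i z
  proof -
    have "Y z \<in> \<Omega>" using Y_mem[OF z] W(2) by blast
    from pd_compose[OF V Y z smooth_on_has_derivative[OF \<Omega> u this]] show ?thesis by (simp add: o_def)
  qed
  show "has_differential (u \<circ> Y) (eps (pfun f) (pd 1 u \<circ> Y) (pd 2 u \<circ> Y)) V"
    unfolding eps_def
    by (rule has_differentialI_pd[OF V smooth_u_Y(1)])
      (simp_all only: chain conjugate_relations eps1_def eps2_def fst_conv snd_conv o_apply)
  show "has_differential (\<lambda>z. Y z $ 1) (eps1 (pfun f) (pd 1 u \<circ> Y) (pd 2 u \<circ> Y)) V"
    unfolding eps1_def by (rule has_differentialI_pd[OF V Y conjugate_relations(1,2)])
  show "has_differential (\<lambda>z. Y z $ 2) (eps2 (pfun f) (pd 1 u \<circ> Y) (pd 2 u \<circ> Y)) V"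
    unfolding eps2_def by (rule has_differentialI_pd[OF V Y conjugate_relations(3,4)])
qed

text \<open>For a competing pair both first coordinates have the differential given by the flux of
  \<open>u\<close>, so they differ by a constant near \<open>x0\<close>, while both second
  coordinates are \<open>f(J)\<close>. Thus \<open>\<Phi>'\<close> is \<open>\<Phi>\<close>
  translated in H, and \<open>\<zeta>1\<close>, \<open>\<zeta>2\<close> are the gradient of
  \<open>u\<close> in the translated coordinates.\<close>

lemma coordinates_unique:
  assumes x0W: "x0 \<in> W" and W': "open W'" "x0 \<in> W'" "W' \<subseteq> \<Omega>" and V': "open V'"
    and hom': "homeomorphism W' V' \<Phi>' Y'"
    and \<Phi>': "\<forall>i. smooth_on W' (\<lambda>x. \<Phi>' x $ i)" and Y': "\<forall>i. smooth_on V' (\<lambda>z. Y' z $ i)"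
    and r': "\<forall>x\<in>W'. \<Phi>' x $ 2 = f (hessdet u x)"
    and \<zeta>: "eq3 (pfun f) V' \<zeta>1" "eq3 (pfun f) V' \<zeta>2"
    and jac': "\<forall>z\<in>V'. jacdet \<zeta>1 \<zeta>2 z > 0"
    and du: "has_differential (u \<circ> Y') (eps (pfun f) \<zeta>1 \<zeta>2) V'"
    and dY: "has_differential (\<lambda>z. Y' z $ 1) (eps1 (pfun f) \<zeta>1 \<zeta>2) V'"
      "has_differential (\<lambda>z. Y' z $ 2) (eps2 (pfun f) \<zeta>1 \<zeta>2) V'"
  obtains c N where "open N" "\<Phi>' x0 \<in> N"
    "\<forall>z\<in>N. \<zeta>1 z = (pd 1 u \<circ> Y) (z - c *\<^sub>R axis 1 1) \<and> \<zeta>2 z = (pd 2 u \<circ> Y) (z - c *\<^sub>R axis 1 1)"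
proof -
  note \<Phi>' = spec[OF \<Phi>'] and Y' = spec[OF Y'] and r' = bspec[OF r'] and jac' = bspec[OF jac']
  \<comment> \<open>The forward map of the locale leads from (H, r) to x, so it is
    \<open>Y'\<close>, with inverse \<open>\<Phi>'\<close>.\<close>
  interpret h: hodograph \<psi> f V' W' Y' \<Phi>' \<zeta>1 \<zeta>2 u
  proof
    show "homeomorphism V' W' Y' \<Phi>'" by (rule homeomorphism_symD[OF hom'])
    show "z $ 2 \<in> f ` {0<..}" if "z \<in> V'" for z
    proof -
      have "Y' z \<in> W'" "\<Phi>' (Y' z) = z" using hom' that by (auto simp: homeomorphism_def)
      moreover have "hessdet u (Y' z) \<in> {0<..}" using J W'(3) \<open>Y' z \<in> W'\<close> by auto
      ultimately show ?thesis using r'[of "Y' z"] by (metis imageI)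
    qed
    show "smooth_on V' \<zeta>1" "smooth_on V' \<zeta>2" using \<zeta> by (simp_all add: eq3_def)
    show "smooth_on W' u" by (rule smooth_on_subset[OF u W'(3)])
    show "has_differential (\<lambda>z. u (Y' z)) (eps (pfun f) \<zeta>1 \<zeta>2) V'" using du by (simp add: o_def)
  qed (fact W'(1) V' \<Phi>' Y' jac' dY)+
  have "open (W \<inter> W')" "x0 \<in> W \<inter> W'" using W W' x0W by auto
  then obtain e where e: "e > 0" "ball x0 e \<subseteq> W \<inter> W'" using openE by blast
  \<comment> \<open>A ball, because a zero derivative forces constancy on a convex set.\<close>
  define B where "B = ball x0 e"
  have B: "open B" "convex B" "x0 \<in> B" "\<And>x. x \<in> B \<Longrightarrow> x \<in> W" "\<And>x. x \<in> B \<Longrightarrow> x \<in> W'"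
    using e by (auto simp: B_def)
  have "\<exists>c. \<forall>x\<in>B. \<Phi>' x $ 1 - \<Phi> x $ 1 = c"
  proof (rule has_derivative_zero_constant[OF B(2)])
    fix x assume x: "x \<in> B"
    have "((\<lambda>x. \<Phi>' x $ 1 - \<Phi> x $ 1) has_derivative (\<lambda>v. (flux2 \<psi> u x * v $ 1 + - flux1 \<psi> u x * v $ 2)
        - (flux2 \<psi> u x * v $ 1 + - flux1 \<psi> u x * v $ 2))) (at x)"
      using smooth_on_has_derivative[OF W'(1) \<Phi>' B(5)[OF x], of 1] smooth_on_has_derivative[OF W(1) \<Phi> B(4)[OF x], of 1]
      by (intro has_derivative_diff) (simp_all add: pdH[OF B(4)[OF x]] h.flux_eq_pd_Y[OF B(5)[OF x]])
    then show "((\<lambda>x. \<Phi>' x $ 1 - \<Phi> x $ 1) has_derivative (\<lambda>v. 0)) (at x within B)"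
      by (simp add: has_derivative_at_withinI)
  qed
  then obtain c where c: "\<And>x. x \<in> B \<Longrightarrow> \<Phi>' x $ 1 - \<Phi> x $ 1 = c" by blast
  \<comment> \<open>This is the image of \<open>B\<close> under \<open>\<Phi>'\<close>; as a
    preimage under \<open>Y'\<close> it is visibly open.\<close>
  define N where "N = V' \<inter> Y' -` B"
  have "open N"
    unfolding N_def using hom' B(1) V' by (intro continuous_open_preimage) (auto simp: homeomorphism_def)
  moreover have "\<Phi>' x0 \<in> N" using hom' W'(2) B(3) by (auto simp: N_def homeomorphism_def)
  moreover have "\<forall>z\<in>N. \<zeta>1 z = (pd 1 u \<circ> Y) (z - c *\<^sub>R axis 1 1) \<and> \<zeta>2 z = (pd 2 u \<circ> Y) (z - c *\<^sub>R axis 1 1)"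
  proof
    fix z assume "z \<in> N"
    define x where "x = Y' z"
    have x: "x \<in> B" "\<Phi>' x = z" using \<open>z \<in> N\<close> hom' by (auto simp: N_def x_def homeomorphism_def)
    have "z - c *\<^sub>R axis 1 1 = \<Phi> x"
      using c[OF x(1)] r[OF B(4)[OF x(1)]] r'[OF B(5)[OF x(1)]] x(2)
      by (auto simp: vec_eq_iff forall_2 axis_pt)
    then have "Y (z - c *\<^sub>R axis 1 1) = x" using Y_\<Phi>[OF B(4)[OF x(1)]] by simp
    then show "\<zeta>1 z = (pd 1 u \<circ> Y) (z - c *\<^sub>R axis 1 1) \<and> \<zeta>2 z = (pd 2 u \<circ> Y) (z - c *\<^sub>R axis 1 1)"
      using h.pd_U[OF B(5)[OF x(1)]] x(2) by simp_all
  qed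
  ultimately show ?thesis by (rule that)
qed

end

end

end

theorem theorem1:
  fixes \<psi> f :: "real \<Rightarrow> real"
  assumes psi_smooth: "smooth1_on {0<..} \<psi>"
    and psi_strict_convex: "strictly_convex_on {0<..} \<psi>"
    and psi_pos: "\<forall>t>0. deriv (deriv \<psi>) t > 0"
    and f_deriv: "\<forall>t>0. (f has_real_derivative (sqrt t * deriv (deriv \<psi>) t)) (at t)"
  shows
  "(\<forall>(S :: (real^2) set) \<xi>1 \<xi>2 z0.
      open S \<and> z0 \<in> S \<and> (\<forall>z\<in>S. z $ 2 \<in> f ` {0<..}) \<and>
      eq3 (pfun f) S \<xi>1 \<and> eq3 (pfun f) S \<xi>2 \<and> jacdet \<xi>1 \<xi>2 z0 > 0 \<longrightarrow>
        closed_form S (eps (pfun f) \<xi>1 \<xi>2) \<and>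
        closed_form S (eps1 (pfun f) \<xi>1 \<xi>2) \<and>
        closed_form S (eps2 (pfun f) \<xi>1 \<xi>2) \<and>
        (\<exists>V. open V \<and> z0 \<in> V \<and> V \<subseteq> S \<and>
           (\<forall>z\<in>V. wedge (eps1 (pfun f) \<xi>1 \<xi>2) (eps2 (pfun f) \<xi>1 \<xi>2) z \<noteq> 0)) \<and>
        (\<exists>V (W :: (real^2) set) u X Y. open V \<and> z0 \<in> V \<and> V \<subseteq> S \<and> open W \<and> convex W \<and>
           homeomorphism V W X Y \<and>
           (\<forall>i. smooth_on V (\<lambda>z. X z $ i)) \<and> (\<forall>i. smooth_on W (\<lambda>w. Y w $ i)) \<and>
           smooth_on V u \<and>
           has_differential u (eps (pfun f) \<xi>1 \<xi>2) V \<and>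
           has_differential (\<lambda>z. X z $ 1) (eps1 (pfun f) \<xi>1 \<xi>2) V \<and>
           has_differential (\<lambda>z. X z $ 2) (eps2 (pfun f) \<xi>1 \<xi>2) V \<and>
           smooth_on W (u \<circ> Y) \<and> strictly_convex_on W (u \<circ> Y) \<and>
           (\<forall>w\<in>W. hessdet (u \<circ> Y) w > 0) \<and>
           eq2 \<psi> W (u \<circ> Y) \<and>
           (\<forall>w\<in>W. pd 1 (u \<circ> Y) w = \<xi>1 (Y w) \<and> pd 2 (u \<circ> Y) w = \<xi>2 (Y w)) \<and>
           (\<forall>w\<in>W. ordinary (u \<circ> Y) w)))
   \<and>
   (\<forall>(\<Omega> :: (real^2) set) u x0.
      open \<Omega> \<and> x0 \<in> \<Omega> \<and> smooth_on \<Omega> u \<and> strictly_convex_on \<Omega> u \<and>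
      (\<forall>x\<in>\<Omega>. hessdet u x > 0) \<and> eq2 \<psi> \<Omega> u \<and> ordinary u x0 \<longrightarrow>
        (\<exists>W V \<Phi> Y. open W \<and> x0 \<in> W \<and> W \<subseteq> \<Omega> \<and> open V \<and>
           homeomorphism W V \<Phi> Y \<and>
           (\<forall>i. smooth_on W (\<lambda>x. \<Phi> x $ i)) \<and> (\<forall>i. smooth_on V (\<lambda>z. Y z $ i)) \<and>
           (\<forall>x\<in>W. \<Phi> x $ 2 = f (hessdet u x)) \<and>
           eq3 (pfun f) V (pd 1 u \<circ> Y) \<and> eq3 (pfun f) V (pd 2 u \<circ> Y) \<and>
           (\<forall>z\<in>V. jacdet (pd 1 u \<circ> Y) (pd 2 u \<circ> Y) z > 0) \<and>
           has_differential (u \<circ> Y) (eps (pfun f) (pd 1 u \<circ> Y) (pd 2 u \<circ> Y)) V \<and>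
           has_differential (\<lambda>z. Y z $ 1) (eps1 (pfun f) (pd 1 u \<circ> Y) (pd 2 u \<circ> Y)) V \<and>
           has_differential (\<lambda>z. Y z $ 2) (eps2 (pfun f) (pd 1 u \<circ> Y) (pd 2 u \<circ> Y)) V \<and>
           (\<forall>W' V' \<Phi>' Y' \<zeta>1 \<zeta>2.
              open W' \<and> x0 \<in> W' \<and> W' \<subseteq> \<Omega> \<and> open V' \<and>
              homeomorphism W' V' \<Phi>' Y' \<and>
              (\<forall>i. smooth_on W' (\<lambda>x. \<Phi>' x $ i)) \<and> (\<forall>i. smooth_on V' (\<lambda>z. Y' z $ i)) \<and>
              (\<forall>x\<in>W'. \<Phi>' x $ 2 = f (hessdet u x)) \<and>
              eq3 (pfun f) V' \<zeta>1 \<and> eq3 (pfun f) V' \<zeta>2 \<and>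
              (\<forall>z\<in>V'. jacdet \<zeta>1 \<zeta>2 z > 0) \<and>
              has_differential (u \<circ> Y') (eps (pfun f) \<zeta>1 \<zeta>2) V' \<and>
              has_differential (\<lambda>z. Y' z $ 1) (eps1 (pfun f) \<zeta>1 \<zeta>2) V' \<and>
              has_differential (\<lambda>z. Y' z $ 2) (eps2 (pfun f) \<zeta>1 \<zeta>2) V' \<longrightarrow>
                (\<exists>c d1 d2 N. open N \<and> \<Phi>' x0 \<in> N \<and>
                   (\<forall>z\<in>N. \<zeta>1 z = (pd 1 u \<circ> Y) (z - c *\<^sub>R axis 1 1) + d1 \<and>
                            \<zeta>2 z = (pd 2 u \<circ> Y) (z - c *\<^sub>R axis 1 1) + d2)))))"
proof -
  interpret density \<psi> f
    using psi_smooth psi_pos f_deriv by unfold_locales auto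
  show ?thesis
  proof ((rule conjI; intro allI impI), goal_cases)
    case (1 S \<xi>1 \<xi>2 z0)
    then have S: "open S" "\<And>z. z \<in> S \<Longrightarrow> z $ 2 \<in> f ` {0<..}" "eq3 (pfun f) S \<xi>1" "eq3 (pfun f) S \<xi>2"
      and z0: "z0 \<in> S" "jacdet \<xi>1 \<xi>2 z0 > 0" by blast+
    obtain V W u X Y where V: "z0 \<in> V" "V \<subseteq> S" and W: "convex W" and u: "smooth_on V u"
      "has_differential u (eps (pfun f) \<xi>1 \<xi>2) V" and hod: "hodograph \<psi> f V W X Y \<xi>1 \<xi>2 (u \<circ> Y)"
      by (rule hodograph_construction[OF S z0])
    interpret h: hodograph \<psi> f V W X Y \<xi>1 \<xi>2 "u \<circ> Y" by (rule hod)
    have wedge: "wedge (eps1 (pfun f) \<xi>1 \<xi>2) (eps2 (pfun f) \<xi>1 \<xi>2) z \<noteq> 0" if "z \<in> V" for z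
      using h.jac_pos[OF that] pfun_pos[OF h.r_range[OF that]] by (simp add: wedge_eps)
    have closed: "closed_form S (eps (pfun f) \<xi>1 \<xi>2)" "closed_form S (eps1 (pfun f) \<xi>1 \<xi>2)"
      "closed_form S (eps2 (pfun f) \<xi>1 \<xi>2)"
      by (rule closed_eps[OF S] closed_eps1[OF S] closed_eps2[OF S]; assumption)+
    show ?case
    proof (intro conjI closed, goal_cases)
      case 1
      show ?case by (rule exI[of _ V]) (intro conjI ballI wedge V h.open_V)
    next
      case 2
      show ?case
        by (rule exI[of _ V], rule exI[of _ W], rule exI[of _ u], rule exI[of _ X], rule exI[of _ Y])
          (intro conjI allI ballI V W u h.open_V h.open_W h.homeo h.X_smooth h.Y_smooth h.dX1 h.dX2 h.U_smooth
            strictly_convex_onI[OF h.open_W W h.U_smooth h.pd_U_pos h.hessdet_U(2)]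
            h.hessdet_U(2) h.eq2_U h.pd_U h.ordinary_U; assumption)
    qed
  next
    case (2 \<Omega> u x0)
    then have \<Omega>: "open \<Omega>" "x0 \<in> \<Omega>" "smooth_on \<Omega> u" "convex_on \<Omega> u"
      "\<And>x. x \<in> \<Omega> \<Longrightarrow> hessdet u x > 0" "eq2 \<psi> \<Omega> u" "ordinary u x0"
      unfolding strictly_convex_on_def by blast+
    obtain W V and \<Phi> Y :: "real^2 \<Rightarrow> real^2" where W: "open W" "x0 \<in> W" "W \<subseteq> \<Omega>"
      and V: "open V" "homeomorphism W V \<Phi> Y"
      and all: "\<forall>i. smooth_on W (\<lambda>x. \<Phi> x $ i)" "\<forall>i. smooth_on V (\<lambda>z. Y z $ i)"
        "\<forall>x\<in>W. \<Phi> x $ 2 = f (hessdet u x)"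
        "\<forall>x\<in>W. pd 1 (\<lambda>x. \<Phi> x $ 1) x = flux2 \<psi> u x"
        "\<forall>x\<in>W. pd 2 (\<lambda>x. \<Phi> x $ 1) x = - flux1 \<psi> u x"
        "\<forall>x\<in>W. jacdet (\<lambda>x. \<Phi> x $ 1) (\<lambda>x. \<Phi> x $ 2) x > 0"
      by (rule hodograph_coordinates[OF \<Omega>])
    \<comment> \<open>Listed in the order of the assumptions of the two nested contexts, so that
      \<open>OF coords\<close> discharges them.\<close>
    note coords = \<Omega> W(1,3) V spec[OF all(1)] spec[OF all(2)] bspec[OF all(3)] bspec[OF all(4)]
      bspec[OF all(5)] bspec[OF all(6)]
    have eq3: "eq3 (pfun f) V (pd 1 u \<circ> Y)" "eq3 (pfun f) V (pd 2 u \<circ> Y)"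
      by (rule coordinates_eq3[OF coords]; assumption)+
    have diffs: "has_differential (u \<circ> Y) (eps (pfun f) (pd 1 u \<circ> Y) (pd 2 u \<circ> Y)) V"
      "has_differential (\<lambda>z. Y z $ 1) (eps1 (pfun f) (pd 1 u \<circ> Y) (pd 2 u \<circ> Y)) V"
      "has_differential (\<lambda>z. Y z $ 2) (eps2 (pfun f) (pd 1 u \<circ> Y) (pd 2 u \<circ> Y)) V"
      by (rule coordinates_differentials[OF coords]; assumption)+
    have jac': "jacdet (pd 1 u \<circ> Y) (pd 2 u \<circ> Y) z > 0" if "z \<in> V" for z
      by (rule conjugate_relations(5)[OF coords]) (assumption | rule that)+
    show ?case
    proof (rule exI[of _ W], rule exI[of _ V], rule exI[of _ \<Phi>], rule exI[of _ Y],
        intro conjI W V all(1-3) eq3 diffs, goal_cases)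
      case 1
      show ?case using jac' by blast
    next
      case 2
      show ?case
      proof (intro allI impI, elim conjE, goal_cases)
        case (1 W' V' \<Phi>' Y' \<zeta>1 \<zeta>2)
        from coordinates_unique[OF coords W(2) 1]
        obtain c N where N: "open N" "\<Phi>' x0 \<in> N" "\<forall>z\<in>N. \<zeta>1 z = (pd 1 u \<circ> Y) (z - c *\<^sub>R axis 1 1) \<and>
            \<zeta>2 z = (pd 2 u \<circ> Y) (z - c *\<^sub>R axis 1 1)"
          by metis
        \<comment> \<open>Both additive constants are 0: the two pairs express the gradient of the
          same \<open>u\<close>.\<close>
        show ?case
          by (rule exI[of _ c], rule exI[of _ 0], rule exI[of _ 0], rule exI[of _ N]) (use N in simp)
      qed
    qed
  qed
qed

end
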